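(* Let $n\ge 1$. The symmetric function $$R_n:=\sum_{d\mid n} c_d(n/d)\,p_d^{\,n/d}$$ is Schur positive. Moreover, if $T_o$ and $T_e$ are disjoint (finite) sets of primes such that $n=n_o n_e$, where $n_o=\prod_{q\in T_o} q^{2a_q+1}$ and $n_e=\prod_{q\in T_e} q^{2b_q}$ for nonnegative integers $a_q,b_q$, then the symmetric function $$\frac{1}{n_o\sqrt{n_e}}\,R_n$$ is also Schur positive.
   Context: $p_d$ is the $d$th power sum symmetric function. For positive integers $d,r$, the Ramanujan sum is $c_d(r)=\sum_{1\le m\le d,\ (m,d)=1}\exp(2\pi i m r/d)$ (an integer). A symmetric function homogeneous of degree $n$ is called Schur positive if it is a nonnegative integer combination of Schur functions (equivalently, the Frobenius characteristic of a true $\mathfrak{S}_n$-module). *)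

theory Defs
  imports
    "HOL-Analysis.Analysis"
    "HOL-Library.FuncSet"
    "HOL-Library.Multiset"
    "HOL-Computational_Algebra.Primes"
begin

section \<open>Formal power series in countably many variables\<close>

text \<open>
  The variables are \<open>x\<^sub>0, x\<^sub>1, x\<^sub>2, \<dots>\<close>. A monomial is the finite multiset of the indices of
  its variables, and a power series is the family of its coefficients. Symmetric functions are
  the symmetric series of bounded degree.
\<close>

typedef 'a mps = "UNIV :: (nat multiset \<Rightarrow> 'a) set"
  morphisms mps_coeff Abs_mps ..

setup_lifting type_definition_mps

lemma mps_eqI: "(\<And>m. mps_coeff f m = mps_coeff g m) \<Longrightarrow> f = g"
  by transfer auto

lemma finite_submultisets: "finite {a. a \<subseteq># (m :: 'b multiset)}"
proof (induction m)
  case empty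
  then show ?case by simp
next
  case (add x m)
  have "{a. a \<subseteq># add_mset x m} \<subseteq> {a. a \<subseteq># m} \<union> add_mset x ` {a. a \<subseteq># m}"
  proof
    fix a assume "a \<in> {a. a \<subseteq># add_mset x m}"
    then have a: "a \<subseteq># add_mset x m" by simp
    show "a \<in> {a. a \<subseteq># m} \<union> add_mset x ` {a. a \<subseteq># m}"
    proof (cases "x \<in># a")
      case True
      then obtain b where "a = add_mset x b" by (metis multi_member_split)
      then show ?thesis using a by auto
    next
      case False
      then have "a \<subseteq># m" using a by (metis count_eq_zero_iff count_add_mset le0 mset_subset_eq_count mset_subset_eqI)
      then show ?thesis by simp
    qed
  qed
  then show ?case using add.IH by (meson finite_UnI finite_imageI finite_subset)
qed

lemma finite_multiset_splits: "finite {(a, b). a + b = (m :: 'b multiset)}"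
proof (rule finite_subset)
  show "{(a, b). a + b = m} \<subseteq> {a. a \<subseteq># m} \<times> {b. b \<subseteq># m}" by auto
  show "finite ({a. a \<subseteq># m} \<times> {b. b \<subseteq># m})"
    by (simp add: finite_submultisets)
qed

instantiation mps :: (comm_ring_1) comm_ring_1
begin

lift_definition zero_mps :: "'a mps" is "\<lambda>_. 0" .

lift_definition one_mps :: "'a mps" is "\<lambda>m. if m = {#} then 1 else 0" .

lift_definition plus_mps :: "'a mps \<Rightarrow> 'a mps \<Rightarrow> 'a mps" is "\<lambda>f g m. f m + g m" .

lift_definition minus_mps :: "'a mps \<Rightarrow> 'a mps \<Rightarrow> 'a mps" is "\<lambda>f g m. f m - g m" .

lift_definition uminus_mps :: "'a mps \<Rightarrow> 'a mps" is "\<lambda>f m. - f m" .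

lift_definition times_mps :: "'a mps \<Rightarrow> 'a mps \<Rightarrow> 'a mps"
  is "\<lambda>f g m. \<Sum>(a, b) \<in> {(a, b). a + b = m}. f a * g b" .

instance
proof
  fix f g h :: "'a mps"
  show "f * g * h = f * (g * h)"
  proof (rule mps_eqI)
    fix m
    let ?S = "\<lambda>m :: nat multiset. {(a, b). a + b = m}"
    have "mps_coeff (f * g * h) m =
        (\<Sum>p\<in>?S m. \<Sum>q\<in>?S (fst p). mps_coeff f (fst q) * mps_coeff g (snd q) * mps_coeff h (snd p))"
      by (simp add: times_mps.rep_eq case_prod_unfold sum_distrib_right)
    also have "\<dots> = (\<Sum>(p, q)\<in>(SIGMA p:?S m. ?S (fst p)).
        mps_coeff f (fst q) * mps_coeff g (snd q) * mps_coeff h (snd p))"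
      by (rule sum.Sigma) (auto simp: finite_multiset_splits)
    also have "\<dots> = (\<Sum>(p, q)\<in>(SIGMA p:?S m. ?S (snd p)).
        mps_coeff f (fst p) * (mps_coeff g (fst q) * mps_coeff h (snd q)))"
      by (rule sum.reindex_bij_witness
          [of _ "\<lambda>((a, b), (c, d)). ((a + c, d), (a, c))"
                "\<lambda>((a, b), (c, d)). ((c, d + b), (d, b))"])
        (auto simp: ac_simps)
    also have "\<dots> = (\<Sum>p\<in>?S m. \<Sum>q\<in>?S (snd p).
        mps_coeff f (fst p) * (mps_coeff g (fst q) * mps_coeff h (snd q)))"
      by (rule sum.Sigma [symmetric]) (auto simp: finite_multiset_splits)
    also have "\<dots> = mps_coeff (f * (g * h)) m"
      by (simp add: times_mps.rep_eq case_prod_unfold sum_distrib_left)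
    finally show "mps_coeff (f * g * h) m = mps_coeff (f * (g * h)) m" .
  qed
  show "f * g = g * f"
  proof (rule mps_eqI)
    fix m
    show "mps_coeff (f * g) m = mps_coeff (g * f) m"
      unfolding times_mps.rep_eq
      by (rule sum.reindex_bij_witness [of _ prod.swap prod.swap]) (auto simp: ac_simps)
  qed
  show "1 * f = f"
  proof (rule mps_eqI)
    fix m
    have "mps_coeff (1 * f) m = (\<Sum>(a, b)\<in>{({#}, m)}. mps_coeff 1 a * mps_coeff f b)"
      unfolding times_mps.rep_eq
      by (rule sum.mono_neutral_right)
        (auto simp: finite_multiset_splits one_mps.rep_eq split: if_splits)
    then show "mps_coeff (1 * f) m = mps_coeff f m" by (simp add: one_mps.rep_eq)
  qed
  show "(f + g) * h = f * h + g * h"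
    by (rule mps_eqI)
      (simp add: times_mps.rep_eq plus_mps.rep_eq case_prod_unfold distrib_right sum.distrib)
  show "f + g + h = f + (g + h)" by transfer (simp add: ac_simps)
  show "f + g = g + f" by transfer (simp add: ac_simps)
  show "0 + f = f" by transfer simp
  show "- f + f = 0" by transfer simp
  show "f - g = f + - g" by transfer simp
  show "(0 :: 'a mps) \<noteq> 1" by transfer (metis zero_neq_one)
qed

end

lift_definition mps_smult :: "'a :: comm_ring_1 \<Rightarrow> 'a mps \<Rightarrow> 'a mps"
  is "\<lambda>c f m. c * f m" .

definition mps_symmetric :: "'a mps \<Rightarrow> bool" where
  "mps_symmetric f \<longleftrightarrow>
     (\<forall>\<pi> m. bij \<pi> \<longrightarrow> mps_coeff f (image_mset \<pi> m) = mps_coeff f m)"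

definition mps_homogeneous :: "nat \<Rightarrow> 'a :: zero mps \<Rightarrow> bool" where
  "mps_homogeneous n f \<longleftrightarrow> (\<forall>m. mps_coeff f m \<noteq> 0 \<longrightarrow> size m = n)"

section \<open>Power sums and Schur functions\<close>

text \<open>The power sum \<open>p\<^sub>d = \<Sum>\<^sub>i x\<^sub>i\<^sup>d\<close>, for \<open>d \<ge> 1\<close>.\<close>

lift_definition power_sum :: "nat \<Rightarrow> 'a :: comm_ring_1 mps"
  is "\<lambda>d m. if \<exists>i. m = replicate_mset d i then 1 else 0" .

definition partitions_of :: "nat \<Rightarrow> nat list set" where
  "partitions_of n = {ps. sorted_wrt (\<ge>) ps \<and> 0 \<notin> set ps \<and> sum_list ps = n}"

definition young_diagram :: "nat list \<Rightarrow> (nat \<times> nat) set" where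
  "young_diagram ps = {(i, j). i < length ps \<and> j < ps ! i}"

text \<open>
  Semistandard tableaux (rows weakly increasing, columns strictly increasing) with entries
  in \<^typ>\<open>nat\<close>; they are extensional, so that each tableau is represented by one function only.
\<close>

definition ssyt :: "nat list \<Rightarrow> (nat \<times> nat \<Rightarrow> nat) set" where
  "ssyt ps = {T \<in> extensional (young_diagram ps).
     (\<forall>i j k. j < k \<and> (i, k) \<in> young_diagram ps \<longrightarrow> T (i, j) \<le> T (i, k)) \<and>
     (\<forall>i j k. i < k \<and> (k, j) \<in> young_diagram ps \<longrightarrow> T (i, j) < T (k, j))}"

definition content :: "nat list \<Rightarrow> (nat \<times> nat \<Rightarrow> nat) \<Rightarrow> nat multiset" where
  "content ps T = image_mset T (mset_set (young_diagram ps))"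

lemma finite_young_diagram: "finite (young_diagram ps)"
proof -
  have "young_diagram ps = (SIGMA i:{..<length ps}. {..<ps ! i})"
    by (auto simp: young_diagram_def)
  then show ?thesis by simp
qed

text \<open>The tableaux counted by a coefficient of a Schur function are finitely many.\<close>

lemma finite_ssyt_content: "finite {T \<in> ssyt ps. content ps T = m}"
proof (rule finite_subset)
  show "{T \<in> ssyt ps. content ps T = m} \<subseteq> young_diagram ps \<rightarrow>\<^sub>E set_mset m"
    by (auto simp: ssyt_def content_def PiE_def finite_young_diagram)
  show "finite (young_diagram ps \<rightarrow>\<^sub>E set_mset m)"
    by (simp add: finite_PiE finite_young_diagram)
qed

lift_definition schur :: "nat list \<Rightarrow> 'a :: comm_ring_1 mps"
  is "\<lambda>ps m. of_nat (card {T \<in> ssyt ps. content ps T = m})" .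

definition schur_positive :: "nat \<Rightarrow> complex mps \<Rightarrow> bool" where
  "schur_positive n f \<longleftrightarrow> mps_symmetric f \<and> mps_homogeneous n f \<and>
     (\<exists>k :: nat list \<Rightarrow> nat. f = (\<Sum>ps\<in>partitions_of n. mps_smult (of_nat (k ps)) (schur ps)))"

text \<open>The sum above ranges over a finite set.\<close>

lemma finite_partitions_of: "finite (partitions_of n)"
proof (rule finite_subset)
  have len: "0 \<notin> set ps \<Longrightarrow> length ps \<le> sum_list ps" for ps :: "nat list"
    by (induction ps) auto
  show "partitions_of n \<subseteq> {ps. set ps \<subseteq> {..n} \<and> length ps \<le> n}"
    using len by (auto simp: partitions_of_def member_le_sum_list)
  show "finite {ps. set ps \<subseteq> {..n} \<and> length ps \<le> n}"
    by (rule finite_lists_length_le) simp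
qed

section \<open>Ramanujan sums\<close>

definition ramanujan_sum :: "nat \<Rightarrow> nat \<Rightarrow> complex" where
  "ramanujan_sum d r = (\<Sum>m | 1 \<le> m \<and> m \<le> d \<and> coprime m d.
     exp (2 * of_real pi * \<i> * of_nat m * of_nat r / of_nat d))"

definition ramanujan_symfun :: "nat \<Rightarrow> complex mps" where
  "ramanujan_symfun n =
     (\<Sum>d | d dvd n. mps_smult (ramanujan_sum d (n div d)) (power_sum d ^ (n div d)))"

end

theory Submission
  imports Defs
begin

text \<open>
  For a partition \<open>\<lambda>\<close> of \<open>n\<close> let \<open>f\<^sub>\<lambda>\<close> be the polynomial \<open>\<Sum> q^maj(T)\<close>, summed over the standard
  tableaux \<open>T\<close> of shape \<open>\<lambda>\<close>. If \<open>z\<close> is a primitive \<open>d\<close>-th root of unity and \<open>d\<close> divides \<open>n\<close>, then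
  \<open>p\<^sub>d^(n/d) = \<Sum>\<^sub>\<lambda> f\<^sub>\<lambda>(z) s\<^sub>\<lambda>\<close> (lemma \<open>power_sum_eq_sum_schur\<close>). A Ramanujan sum \<open>c\<^sub>d(r)\<close> adds up
  \<open>z^r\<close> over these \<open>z\<close>, and as \<open>d\<close> runs through the divisors of \<open>n\<close> the roots \<open>z\<close> run once through
  all \<open>n\<close>-th roots of unity. Averaging over them picks out the exponents in one residue class, so
  \<open>\<Sum>\<^bsub>d|n\<^esub> c\<^sub>d(r) p\<^sub>d^(n/d)\<close> is \<open>n\<close> times the sum of the \<open>s\<^sub>\<lambda>\<close>, each taken as often as there are
  standard tableaux with \<open>maj \<equiv> -r (mod n)\<close> (lemma \<open>foulkes_schur_expansion\<close>): up to the factor \<open>n\<close>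
  it is the characteristic of a character induced from a cyclic group of order \<open>n\<close>.

  In the function at hand the argument \<open>n/d\<close> of the Ramanujan sum varies with \<open>d\<close>. Write
  \<open>n = A N\<^sub>0\<^sup>2 E\<^sup>2\<close> with \<open>A = \<Prod> q\<close>, \<open>N\<^sub>0 = \<Prod> q^a(q)\<close> over \<open>T\<^sub>o\<close> and \<open>E = \<Prod> q^b(q)\<close> over \<open>T\<^sub>e\<close>, so
  that \<open>n\<^sub>o = A N\<^sub>0\<^sup>2\<close> and \<open>n\<^sub>e = E\<^sup>2\<close>. Prime by prime one finds that
  \<open>E c\<^sub>d(n/d) = \<Sum>\<^bsub>t<E\<^esub> c\<^sub>d(r\<^sub>t)\<close> with \<open>r\<^sub>t = N\<^sub>0 E (1 + n\<^sub>o t)\<close> independent of \<open>d\<close>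
  (lemma \<open>ramanujan_sum_as_average\<close>). Hence \<open>E R\<^sub>n\<close> is \<open>n\<close> times a Schur positive function, and
  \<open>n/E = n\<^sub>o E = n\<^sub>o \<surd>n\<^sub>e\<close> can be divided out. Every \<open>n\<close> has such a factorisation, which also gives
  the positivity of \<open>R\<^sub>n\<close> itself.

  The expansion of \<open>p\<^sub>d^(n/d)\<close> is proved by comparing coefficients. The specialisation
  \<open>s\<^sub>\<lambda>(1,q,q\<^sup>2,\<dots>)\<close> equals \<open>f\<^sub>\<lambda>(q) / (q;q)\<^sub>n\<close> and satisfies the Pieri rule with
  \<open>h\<^sub>m(1,q,q\<^sup>2,\<dots>) = 1 / (q;q)\<^sub>m\<close> (lemma \<open>principal_pieri\<close>). Building semistandard tableaux one entry
  at a time therefore gives \<open>\<Sum>\<^sub>\<lambda> K\<^sub>\<lambda>\<^sub>\<mu> f\<^sub>\<lambda>(q) = (q;q)\<^sub>n / \<Prod>\<^sub>i (q;q)\<^bsub>\<mu>\<^sub>i\<^esub>\<close>, a \<open>q\<close>-multinomial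
  coefficient (lemma \<open>sum_tableaux_maj_poly\<close>). At \<open>q = z\<close> it becomes the ordinary multinomial
  coefficient of the \<open>\<mu>\<^sub>i/d\<close> if \<open>d\<close> divides all \<open>\<mu>\<^sub>i\<close>, and \<open>0\<close> otherwise, which is the coefficient
  of \<open>x^\<mu>\<close> in \<open>p\<^sub>d^(n/d)\<close>.
\<close>


section \<open>Shapes and horizontal strips\<close>

definition boxes :: "(nat \<Rightarrow> nat) \<Rightarrow> nat" where
  "boxes f = (\<Sum>i | f i \<noteq> 0. f i)"

text \<open>
  Partitions are kept as functions with value \<open>0\<close> beyond the last row: adding a row needs no case
  distinction, and equality of shapes is equality of functions.
\<close>

definition shapes :: "nat \<Rightarrow> (nat \<Rightarrow> nat) set" where
  "shapes n = {f. (\<forall>i. f (Suc i) \<le> f i) \<and> finite {i. f i \<noteq> 0} \<and> boxes f = n}"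

text \<open>
  The interlacing \<open>f\<^sub>0 \<ge> g\<^sub>0 \<ge> f\<^sub>1 \<ge> g\<^sub>1 \<ge> \<dots>\<close>, which says that the boxes of \<open>f\<close> outside \<open>g\<close> lie in
  different columns. If \<open>f\<close> or \<open>g\<close> is a partition, then so is the other.
\<close>

definition horizontal_strip :: "(nat \<Rightarrow> nat) \<Rightarrow> (nat \<Rightarrow> nat) \<Rightarrow> bool" where
  "horizontal_strip g f \<longleftrightarrow> (\<forall>i. g i \<le> f i \<and> f (Suc i) \<le> g i)"

lemma stripD: "horizontal_strip g f \<Longrightarrow> g i \<le> f i" "horizontal_strip g f \<Longrightarrow> f (Suc i) \<le> g i"
  by (auto simp: horizontal_strip_def)

lemma support_bounded:
  fixes f :: "nat \<Rightarrow> nat"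
  assumes "\<And>i. i \<ge> L \<Longrightarrow> f i = 0"
  shows "{i. f i \<noteq> 0} \<subseteq> {..<L}"
  using assms by (metis (mono_tags, lifting) lessThan_iff linorder_not_le mem_Collect_eq subsetI)

lemma boxes_eq_sum:
  assumes "\<And>i. i \<ge> L \<Longrightarrow> f i = 0"
  shows "boxes f = sum f {..<L}"
  unfolding boxes_def
  by (rule sum.mono_neutral_left) (use support_bounded[OF assms] in auto)

lemma boxes_of_shape: "f \<in> shapes n \<Longrightarrow> boxes f = n"
  by (simp add: shapes_def)

lemma shapes_antimono: "f \<in> shapes n \<Longrightarrow> i \<le> j \<Longrightarrow> f j \<le> f i"
  unfolding shapes_def using lift_Suc_antimono_le[of f i j] by auto

lemma shapes_row_zero:
  assumes "f \<in> shapes n" "i \<ge> n"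
  shows "f i = 0"
proof (rule ccontr)
  assume "f i \<noteq> 0"
  then have pos: "1 \<le> f k" if "k \<le> i" for k
    using shapes_antimono[OF assms(1) that] by simp
  have "Suc i = (\<Sum>k\<in>{..i}. 1)" by simp
  also have "\<dots> \<le> (\<Sum>k\<in>{..i}. f k)"
    using pos by (intro sum_mono) auto
  also have "\<dots> \<le> boxes f"
    unfolding boxes_def
    by (rule sum_mono2) (use assms pos in \<open>auto simp: shapes_def dest: pos\<close>)
  finally show False using assms by (simp add: shapes_def)
qed

lemma shapes_sum: "f \<in> shapes n \<Longrightarrow> L \<ge> n \<Longrightarrow> sum f {..<L} = n"
  by (subst boxes_eq_sum[symmetric]) (auto simp: shapes_row_zero boxes_of_shape)

lemma shapes_row_le:
  assumes "f \<in> shapes n"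
  shows "f i \<le> n"
proof (cases "i < n")
  case True
  then have "f i \<le> sum f {..<n}" by (intro member_le_sum) auto
  then show ?thesis using shapes_sum[OF assms] by simp
qed (simp add: shapes_row_zero[OF assms])

lemma shapesI:
  assumes "\<And>i. f (Suc i) \<le> f i" "\<And>i. i \<ge> L \<Longrightarrow> f i = 0" "sum f {..<L} = n"
  shows "f \<in> shapes n"
proof -
  have "{i. f i \<noteq> 0} \<subseteq> {..<L}" using assms(2) by (rule support_bounded)
  then show ?thesis
    using assms boxes_eq_sum[of L f, OF assms(2)] finite_subset by (simp add: shapes_def) blast
qed

lemma finite_shapes: "finite (shapes n)"
proof (rule finite_subset)
  show "shapes n \<subseteq> {f. \<forall>i. (i \<in> {..<n} \<longrightarrow> f i \<in> {..n}) \<and> (i \<notin> {..<n} \<longrightarrow> f i = 0)}"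
    using shapes_row_zero shapes_row_le by auto
  show "finite {f. \<forall>i. (i \<in> {..<n} \<longrightarrow> f i \<in> {..n}) \<and> (i \<notin> {..<n} \<longrightarrow> f i = (0::nat))}"
    by (rule finite_set_of_finite_funs) auto
qed

lemma shapes_0: "shapes 0 = {\<lambda>_. 0}"
proof -
  have "f = (\<lambda>_. 0)" if "f \<in> shapes 0" for f
    using shapes_row_zero[OF that] by auto
  moreover have "(\<lambda>_. 0) \<in> shapes 0" by (rule shapesI[where L=0]) auto
  ultimately show ?thesis by blast
qed

lemma shape_below:
  assumes "f \<in> shapes n" "horizontal_strip g f"
  shows "g \<in> shapes (boxes g)" "boxes g \<le> n"
proof -
  have z: "g i = 0" if "i \<ge> n" for i
    using shapes_row_zero[OF assms(1) that] stripD(1)[OF assms(2), of i] by simp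
  have bs: "boxes g = sum g {..<n}"
    by (rule boxes_eq_sum) (rule z)
  show "g \<in> shapes (boxes g)"
  proof (rule shapesI)
    show "g (Suc i) \<le> g i" for i
      using stripD(1)[OF assms(2), of "Suc i"] stripD(2)[OF assms(2), of i] by linarith
  qed (use z bs in auto)
  have "boxes g \<le> sum f {..<n}"
    unfolding bs by (intro sum_mono stripD(1)[OF assms(2)])
  then show "boxes g \<le> n" using shapes_sum[OF assms(1)] by simp
qed

lemma shape_below_eq:
  assumes "f \<in> shapes n" "horizontal_strip g f" "boxes g = n"
  shows "g = f"
proof -
  have z: "g i = 0" "f i = 0" if "i \<ge> n" for i
    using shapes_row_zero[OF assms(1) that] stripD(1)[OF assms(2), of i] by auto
  have "boxes g = sum g {..<n}"
    by (rule boxes_eq_sum) (rule z(1))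
  then have "sum g {..<n} = sum f {..<n}"
    using assms(3) shapes_sum[OF assms(1)] by simp
  then have "g i = f i" if "i < n" for i
    by (rule sum_mono_inv) (use stripD(1)[OF assms(2)] that in auto)
  then show ?thesis
    using z by (metis ext linorder_not_le)
qed

lemma shape_above:
  assumes "g \<in> shapes n" "horizontal_strip g f"
  shows "f \<in> shapes (boxes f)" "n \<le> boxes f"
proof -
  have z: "f i = 0" if "i \<ge> Suc n" for i
    using shapes_row_zero[OF assms(1), of "i - 1"] stripD(2)[OF assms(2), of "i - 1"] that by simp
  have bs: "boxes f = sum f {..<Suc n}"
    by (rule boxes_eq_sum) (rule z)
  show "f \<in> shapes (boxes f)"
  proof (rule shapesI)
    show "f (Suc i) \<le> f i" for i
      using stripD(1)[OF assms(2), of i] stripD(2)[OF assms(2), of i] by linarith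
  qed (use z bs in auto)
  have "sum g {..<Suc n} \<le> boxes f"
    unfolding bs by (intro sum_mono stripD(1)[OF assms(2)])
  then show "n \<le> boxes f" using shapes_sum[OF assms(1), of "Suc n"] by simp
qed

lemma strip_refl: "f \<in> shapes n \<Longrightarrow> horizontal_strip f f"
  by (auto simp: horizontal_strip_def shapes_def)

lemma finite_strip_below: "f \<in> shapes n \<Longrightarrow> finite {g. horizontal_strip g f}"
  by (rule finite_subset[of _ "\<Union>k\<le>n. shapes k"]) (use shape_below in \<open>force simp: finite_shapes\<close>)+

lemma finite_strip_above: "g \<in> shapes n \<Longrightarrow> finite {f. horizontal_strip g f \<and> boxes f = k}"
  by (rule finite_subset[of _ "shapes k"]) (use shape_above in \<open>force simp: finite_shapes\<close>)+

text \<open>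
  For shapes \<open>\<nu>\<close>, \<open>\<kappa>\<close> below \<open>\<mu>\<close>, row \<open>i + 1\<close> of \<open>\<mu>\<close> and row \<open>i\<close> of a shape \<open>\<tau>\<close> below both \<open>\<nu>\<close> and
  \<open>\<kappa>\<close> are confined to the same interval; reflecting the one in this interval gives the other. Since
  \<open>max + min\<close> is the sum, the sizes balance except for the first row of \<open>\<mu>\<close>, which is unbounded.
\<close>

lemma boxes_toggle:
  assumes "\<nu> \<in> shapes a" "\<kappa> \<in> shapes b" "horizontal_strip \<nu> \<mu>"
    and "\<And>i. \<tau> i + \<mu> (Suc i) = max (\<nu> (Suc i)) (\<kappa> (Suc i)) + min (\<nu> i) (\<kappa> i)"
  shows "boxes \<mu> + boxes \<tau> + max (\<nu> 0) (\<kappa> 0) = \<mu> 0 + a + b"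
proof -
  define L where "L = Suc (a + b)"
  have z: "\<nu> i = 0" "\<kappa> i = 0" if "i \<ge> a + b" for i
    using shapes_row_zero assms(1,2) that by auto
  have z\<mu>: "\<mu> i = 0" if "i \<ge> L" for i
    using z(1)[of "i - 1"] stripD(2)[OF assms(3), of "i - 1"] that by (simp add: L_def)
  have z\<tau>: "\<tau> i = 0" if "i \<ge> L" for i
    using assms(4)[of i] z[of i] z[of "Suc i"] that by (simp add: L_def)
  have shift: "h 0 + (\<Sum>i<L. h (Suc i)) = sum h {..<L}" if "h L = 0" for h :: "nat \<Rightarrow> nat"
    using sum.lessThan_Suc_shift[of h L] that by simp
  have "(\<Sum>i<L. \<tau> i) + (\<Sum>i<L. \<mu> (Suc i))
      = (\<Sum>i<L. max (\<nu> (Suc i)) (\<kappa> (Suc i))) + (\<Sum>i<L. min (\<nu> i) (\<kappa> i))"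
    unfolding sum.distrib[symmetric] by (intro sum.cong assms(4) refl)
  moreover have "\<mu> 0 + (\<Sum>i<L. \<mu> (Suc i)) = boxes \<mu>"
    using shift[of \<mu>] z\<mu> boxes_eq_sum[of L \<mu>] by simp
  moreover have "boxes \<tau> = (\<Sum>i<L. \<tau> i)"
    by (rule boxes_eq_sum) (rule z\<tau>)
  moreover have "max (\<nu> 0) (\<kappa> 0) + (\<Sum>i<L. max (\<nu> (Suc i)) (\<kappa> (Suc i))) = (\<Sum>i<L. max (\<nu> i) (\<kappa> i))"
    using shift[of "\<lambda>i. max (\<nu> i) (\<kappa> i)"] z[of L] by (simp add: L_def)
  moreover have "(\<Sum>i<L. max (\<nu> i) (\<kappa> i)) + (\<Sum>i<L. min (\<nu> i) (\<kappa> i)) = a + b"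
  proof -
    have "(\<Sum>i<L. max (\<nu> i) (\<kappa> i)) + (\<Sum>i<L. min (\<nu> i) (\<kappa> i)) = (\<Sum>i<L. \<nu> i + \<kappa> i)"
      unfolding sum.distrib[symmetric] by (intro sum.cong) (auto simp: max_def min_def)
    then show ?thesis
      using shapes_sum[OF assms(1), of L] shapes_sum[OF assms(2), of L] by (simp add: sum.distrib L_def)
  qed
  ultimately show ?thesis by linarith
qed

text \<open>
  The commutation of adding and removing horizontal strips. Reflecting each row as in
  \<open>boxes_toggle\<close> turns a common upper bound \<open>\<mu>\<close> of \<open>\<nu>\<close> and \<open>\<kappa>\<close> into a common lower bound \<open>\<tau>\<close>; the
  first row of \<open>\<mu>\<close> is lost, but it is recovered from the prescribed size of \<open>\<mu>\<close>, and the condition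
  that it be long enough is the inequality on \<open>boxes \<tau>\<close>.
\<close>

lemma strip_exchange:
  assumes \<nu>: "\<nu> \<in> shapes a" and \<kappa>: "\<kappa> \<in> shapes b"
  shows "card {\<mu>. horizontal_strip \<nu> \<mu> \<and> horizontal_strip \<kappa> \<mu> \<and> boxes \<mu> = a + m}
       = card {\<tau>. horizontal_strip \<tau> \<nu> \<and> horizontal_strip \<tau> \<kappa> \<and> b \<le> boxes \<tau> + m}"
proof -
  define I where "I i = max (\<nu> (Suc i)) (\<kappa> (Suc i)) + min (\<nu> i) (\<kappa> i)" for i
  define down where "down \<mu> = (\<lambda>i. I i - \<mu> (Suc i))" for \<mu> :: "nat \<Rightarrow> nat"
  define up where "up \<tau> = (\<lambda>i. case i of 0 \<Rightarrow> max (\<nu> 0) (\<kappa> 0) + (boxes \<tau> + m - b)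
                                | Suc k \<Rightarrow> I k - \<tau> k)" for \<tau> :: "nat \<Rightarrow> nat"
  have dI: "down \<mu> i + \<mu> (Suc i) = I i"
    if "horizontal_strip \<nu> \<mu>" "horizontal_strip \<kappa> \<mu>" for \<mu> i
    using stripD[OF that(1), of i] stripD[OF that(2), of i] by (auto simp: down_def I_def)
  have uI: "\<tau> i + up \<tau> (Suc i) = I i"
    if "horizontal_strip \<tau> \<nu>" "horizontal_strip \<tau> \<kappa>" for \<tau> i
    using stripD[OF that(1), of i] stripD[OF that(2), of i] by (auto simp: up_def I_def)
  have down: "horizontal_strip (down \<mu>) \<nu>" "horizontal_strip (down \<mu>) \<kappa>" "b \<le> boxes (down \<mu>) + m" "up (down \<mu>) = \<mu>"
    if \<mu>: "horizontal_strip \<nu> \<mu>" "horizontal_strip \<kappa> \<mu>" "boxes \<mu> = a + m" for \<mu>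
  proof -
    have r: "\<nu> (Suc i) \<le> down \<mu> i" "\<kappa> (Suc i) \<le> down \<mu> i"
       "down \<mu> i \<le> \<nu> i" "down \<mu> i \<le> \<kappa> i" for i
      using dI[OF \<mu>(1,2), of i] stripD[OF \<mu>(1), of i] stripD[OF \<mu>(2), of i]
        stripD[OF \<mu>(1), of "Suc i"] stripD[OF \<mu>(2), of "Suc i"] by (auto simp: I_def)
    show "horizontal_strip (down \<mu>) \<nu>" "horizontal_strip (down \<mu>) \<kappa>"
      using r by (auto simp: horizontal_strip_def)
    have eq: "boxes \<mu> + boxes (down \<mu>) + max (\<nu> 0) (\<kappa> 0) = \<mu> 0 + a + b"
      by (rule boxes_toggle[OF \<nu> \<kappa> \<mu>(1)]) (use dI[OF \<mu>(1,2)] in \<open>simp add: I_def\<close>)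
    moreover have ge: "max (\<nu> 0) (\<kappa> 0) \<le> \<mu> 0"
      using stripD(1)[OF \<mu>(1), of 0] stripD(1)[OF \<mu>(2), of 0] by simp
    ultimately show "b \<le> boxes (down \<mu>) + m" using \<mu>(3) by linarith
    show "up (down \<mu>) = \<mu>"
    proof
      fix i
      show "up (down \<mu>) i = \<mu> i"
      proof (cases i)
        case 0
        have "max (\<nu> 0) (\<kappa> 0) + (boxes (down \<mu>) + m - b) = \<mu> 0"
          using eq ge \<mu>(3) by linarith
        then show ?thesis using 0 by (simp add: up_def)
      next
        case (Suc k)
        then show ?thesis using dI[OF \<mu>(1,2), of k] by (simp add: up_def)
      qed
    qed
  qed
  have up: "horizontal_strip \<nu> (up \<tau>)" "horizontal_strip \<kappa> (up \<tau>)" "boxes (up \<tau>) = a + m" "down (up \<tau>) = \<tau>"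
    if \<tau>: "horizontal_strip \<tau> \<nu>" "horizontal_strip \<tau> \<kappa>" "b \<le> boxes \<tau> + m" for \<tau>
  proof -
    have r: "\<nu> (Suc i) \<le> up \<tau> (Suc i)" "\<kappa> (Suc i) \<le> up \<tau> (Suc i)"
       "up \<tau> (Suc i) \<le> \<nu> i" "up \<tau> (Suc i) \<le> \<kappa> i" for i
      using uI[OF \<tau>(1,2), of i] stripD[OF \<tau>(1), of i] stripD[OF \<tau>(2), of i] by (auto simp: I_def)
    have r0: "\<nu> 0 \<le> up \<tau> 0" "\<kappa> 0 \<le> up \<tau> 0" by (auto simp: up_def)
    have "\<nu> i \<le> up \<tau> i" "\<kappa> i \<le> up \<tau> i" for i
      using r r0 by (cases i; simp)+
    then show s: "horizontal_strip \<nu> (up \<tau>)" "horizontal_strip \<kappa> (up \<tau>)"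
      using r by (auto simp: horizontal_strip_def)
    have "boxes (up \<tau>) + boxes \<tau> + max (\<nu> 0) (\<kappa> 0) = up \<tau> 0 + a + b"
      by (rule boxes_toggle[OF \<nu> \<kappa> s(1)]) (use uI[OF \<tau>(1,2)] in \<open>simp add: I_def\<close>)
    moreover have "up \<tau> 0 = max (\<nu> 0) (\<kappa> 0) + (boxes \<tau> + m - b)" by (simp add: up_def)
    ultimately show "boxes (up \<tau>) = a + m" using \<tau>(3) by linarith
    show "down (up \<tau>) = \<tau>"
      using uI[OF \<tau>(1,2)] by (auto simp: down_def fun_eq_iff) (metis add_diff_cancel_right')
  qed
  show ?thesis
    by (rule bij_betw_same_card[of down], rule bij_betw_byWitness[where f'=up])
      (use down up in auto)
qed

section \<open>Major index generating functions and principal specialisations\<close>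

text \<open>
The \<open>q\<close>-Pochhammer symbol \<open>(q;q)\<^sub>n\<close> as a polynomial in \<open>q\<close>.
\<close>

definition qpoch :: "nat \<Rightarrow> complex poly" where
  "qpoch n = (\<Prod>k=1..n. 1 - monom 1 k)"

lemma qpoch_0 [simp]: "qpoch 0 = 1"
  by (simp add: qpoch_def)

lemma qpoch_Suc: "qpoch (Suc n) = qpoch n * (1 - monom 1 (Suc n))"
  by (simp add: qpoch_def)

definition no_root_of_unity :: "complex \<Rightarrow> bool" where
  "no_root_of_unity q \<longleftrightarrow> (\<forall>k\<ge>1. q ^ k \<noteq> 1)"

lemma qpoch_nonzero: "no_root_of_unity q \<Longrightarrow> poly (qpoch n) q \<noteq> 0"
  by (auto simp: qpoch_def poly_prod poly_monom no_root_of_unity_def)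

text \<open>
  The sum of \<open>q^maj(T)\<close> over the standard tableaux \<open>T\<close> of shape \<open>f\<close> with \<open>n\<close> boxes whose largest entry
  stands in row \<open>j\<close>. Without this entry, the entry \<open>n\<close> of a tableau with \<open>n + 1\<close> boxes is in some row
  \<open>i\<close>, and it is a descent, contributing \<open>n\<close> to \<open>maj\<close>, exactly if \<open>i < j\<close>. The empty tableau is
  assigned to row \<open>0\<close>, so that a first box creates no descent.
\<close>

fun maj_last :: "nat \<Rightarrow> (nat \<Rightarrow> nat) \<Rightarrow> nat \<Rightarrow> complex poly" where
  "maj_last 0 f j = (if j = 0 then 1 else 0)"
| "maj_last (Suc n) f j = (if f (Suc j) < f j
     then (\<Sum>i\<le>n. (if i < j then monom 1 n else 1) * maj_last n (f(j := f j - 1)) i) else 0)"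

definition maj_poly :: "nat \<Rightarrow> (nat \<Rightarrow> nat) \<Rightarrow> complex poly" where
  "maj_poly n f = (\<Sum>j\<le>n. maj_last n f j)"

lemma sum_in_Nats: "(\<And>i. i \<in> I \<Longrightarrow> h i \<in> \<nat>) \<Longrightarrow> (\<Sum>i\<in>I. h i :: 'a :: semiring_1) \<in> \<nat>"
  by (induction I rule: infinite_finite_induct) auto

lemma maj_last_coeff_Nats: "coeff (maj_last n f j) e \<in> \<nat>"
proof (induction n arbitrary: f j e)
  case (Suc n)
  have "coeff ((if i < j then monom 1 n else 1) * maj_last n g i) e \<in> \<nat>" for i g
    using Suc.IH by (simp add: coeff_monom_mult)
  then show ?case
    by (simp add: coeff_sum del: if_split) (auto intro!: sum_in_Nats)
qed simp

lemma maj_poly_coeff_Nats: "coeff (maj_poly n f) e \<in> \<nat>"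
  using maj_last_coeff_Nats by (auto simp: maj_poly_def coeff_sum intro!: sum_in_Nats)

definition principal_last :: "complex \<Rightarrow> nat \<Rightarrow> (nat \<Rightarrow> nat) \<Rightarrow> nat \<Rightarrow> complex" where
  "principal_last q n f j = poly (maj_last n f j) q / poly (qpoch n) q"

text \<open>
  The value \<open>s\<^sub>f(1,q,q\<^sup>2,\<dots>)\<close>, written as a fraction so that it makes sense at every \<open>q\<close> that is not a
  root of unity. The recursion \<open>principal_rec\<close> is the link to tableaux.
\<close>

definition principal :: "complex \<Rightarrow> nat \<Rightarrow> (nat \<Rightarrow> nat) \<Rightarrow> complex" where
  "principal q n f = poly (maj_poly n f) q / poly (qpoch n) q"

lemma principal_eq_sum: "principal q n f = (\<Sum>j\<le>n. principal_last q n f j)"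
  by (simp add: principal_def principal_last_def maj_poly_def poly_sum sum_divide_distrib)

text \<open>
The shapes below \<open>f\<close> for which the removed boxes start in row \<open>j\<close>.
\<close>

definition top_strips :: "(nat \<Rightarrow> nat) \<Rightarrow> nat \<Rightarrow> (nat \<Rightarrow> nat) set" where
  "top_strips f j = {g. horizontal_strip g f \<and> g j < f j \<and> (\<forall>i<j. g i = f i)}"

lemma finite_top_strips: "f \<in> shapes n \<Longrightarrow> finite (top_strips f j)"
  by (rule finite_subset[OF _ finite_strip_below]) (auto simp: top_strips_def)

lemma top_strips_disjoint: "i \<noteq> j \<Longrightarrow> top_strips f i \<inter> top_strips f j = {}"
  unfolding top_strips_def disjoint_iff mem_Collect_eq by (metis less_irrefl linorder_neqE_nat)

lemma strips_decompose:
  assumes "f \<in> shapes n"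
  shows "{g. horizontal_strip g f} = insert f (\<Union>j\<le>n. top_strips f j)"
proof -
  have "\<exists>j\<le>n. g \<in> top_strips f j" if g: "horizontal_strip g f" "g \<noteq> f" for g
  proof -
    obtain j where j: "g j \<noteq> f j" and lt: "\<forall>i<j. g i = f i"
      using exists_least_iff[of "\<lambda>j. g j \<noteq> f j"] g(2) by (auto simp: fun_eq_iff)
    have "g j < f j" using j stripD(1)[OF g(1), of j] by simp
    moreover from this have "j < n"
      using shapes_row_zero[OF assms, of j] by (cases "j < n") auto
    ultimately have "j \<le> n \<and> g \<in> top_strips f j" using g(1) lt by (simp add: top_strips_def)
    then show ?thesis by blast
  qed
  moreover have "horizontal_strip g f" if "g \<in> top_strips f j" for g j
    using that by (simp add: top_strips_def)
  ultimately show ?thesis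
    using strip_refl[OF assms] by blast
qed

lemma remove_corner:
  assumes "f \<in> shapes (Suc n)" "f (Suc j) < f j"
  shows "f(j := f j - 1) \<in> shapes n" "horizontal_strip (f(j := f j - 1)) f"
proof -
  have anti: "f (Suc i) \<le> f i" for i
    using shapes_antimono[OF assms(1)] by simp
  show s: "horizontal_strip (f(j := f j - 1)) f"
    using assms(2) anti by (auto simp: horizontal_strip_def)
  have j: "j < Suc n"
    using shapes_row_zero[OF assms(1), of j] assms(2) by (cases "j < Suc n") auto
  have "sum (f(j := f j - 1)) {..<Suc n} = n"
  proof -
    have "sum f {..<Suc n} = f j + sum f ({..<Suc n} - {j})"
      using j by (intro sum.remove) auto
    moreover have "sum (f(j := f j - 1)) {..<Suc n}
        = (f j - 1) + sum f ({..<Suc n} - {j})"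
      using j by (subst sum.remove[of _ j]) (auto intro!: sum.cong)
    ultimately show ?thesis
      using shapes_sum[OF assms(1), of "Suc n"] assms(2) by simp
  qed
  moreover have z: "(f(j := f j - 1)) i = 0" if "i \<ge> Suc n" for i
    using shapes_row_zero[OF assms(1) that] that j by auto
  ultimately have "boxes (f(j := f j - 1)) = n"
    using boxes_eq_sum[of "Suc n" "f(j := f j - 1)"] by simp
  then show "f(j := f j - 1) \<in> shapes n"
    using shape_below(1)[OF assms(1) s] by simp
qed

text \<open>
  A horizontal strip whose uppermost row is \<open>j\<close> contains the last box of that row. Without this box,
  either nothing is left, or a strip whose uppermost row is \<open>j\<close> or lower.
\<close>

lemma top_strips_remove_corner:
  assumes f: "f \<in> shapes (Suc n)" and j: "f (Suc j) < f j"
  shows "top_strips f j = insert (f(j := f j - 1)) (\<Union>i\<in>{j..n}. top_strips (f(j := f j - 1)) i)"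
    (is "_ = insert ?h _")
proof (intro equalityI subsetI)
  fix g assume "g \<in> top_strips f j"
  then have g: "horizontal_strip g f" "g j < f j" "\<And>i. i < j \<Longrightarrow> g i = f i"
    by (auto simp: top_strips_def)
  have h: "horizontal_strip g ?h"
  proof -
    have "g i \<le> ?h i" "?h (Suc i) \<le> g i" for i
      using stripD[OF g(1), of i] g(2) by auto
    then show ?thesis by (simp add: horizontal_strip_def)
  qed
  then have "g = ?h \<or> (\<exists>i\<le>n. g \<in> top_strips ?h i)"
    using strips_decompose[OF remove_corner(1)[OF f j]] by blast
  moreover have "j \<le> i" if "g \<in> top_strips ?h i" for i
  proof (rule ccontr)
    assume "\<not> j \<le> i"
    then show False using that g(3)[of i] by (auto simp: top_strips_def)
  qed
  ultimately have "g = ?h \<or> (\<exists>i\<in>{j..n}. g \<in> top_strips ?h i)"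
    by (meson atLeastAtMost_iff)
  then show "g \<in> insert ?h (\<Union>i\<in>{j..n}. top_strips ?h i)"
    by (simp only: insert_iff UN_iff)
next
  fix g assume "g \<in> insert ?h (\<Union>i\<in>{j..n}. top_strips ?h i)"
  then consider "g = ?h" | i where "j \<le> i" "g \<in> top_strips ?h i" by auto
  then show "g \<in> top_strips f j"
  proof cases
    case 1
    then show ?thesis using remove_corner(2)[OF f j] j by (auto simp: top_strips_def)
  next
    case 2
    then have s: "horizontal_strip g ?h" and eq: "\<And>k. k < i \<Longrightarrow> g k = ?h k" by (auto simp: top_strips_def)
    have "g k \<le> f k" for k
      using stripD(1)[OF s, of k] by (cases "k = j") auto
    moreover have "f (Suc k) \<le> g k" for k
    proof (cases "Suc k = j")
      case True
      then show ?thesis using eq[of k] 2(1) shapes_antimono[OF f, of k "Suc k"] by simp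
    next
      case False
      then show ?thesis using stripD(2)[OF s, of k] by simp
    qed
    moreover have "g j < f j" using stripD(1)[OF s, of j] j by simp
    moreover have "g k = f k" if "k < j" for k using eq[of k] that 2(1) by simp
    ultimately show ?thesis by (simp add: top_strips_def horizontal_strip_def)
  qed
qed

text \<open>
  For \<open>n = m + 1\<close> and \<open>h\<close> the shape \<open>f\<close> without its last box in row \<open>j\<close>, the recursion of
  \<open>maj_last\<close> weights the rows above \<open>j\<close> by \<open>q^m\<close> and the others by \<open>1 = q^m + (1 - q^m)\<close>. The
  parts with \<open>q^m\<close> add up to the summand of \<open>h\<close>, and by induction the parts with \<open>1 - q^m\<close> give the
  strips below \<open>h\<close> that start in row \<open>j\<close> or lower.
\<close>

lemma principal_last_rec:
  assumes q: "no_root_of_unity q" and "f \<in> shapes n"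
  shows "(1 - q ^ n) * principal_last q n f j = (\<Sum>g\<in>top_strips f j. q ^ boxes g * principal q (boxes g) g)"
  using assms(2)
proof (induction n arbitrary: f j)
  case 0
  then have "top_strips f j = {}" by (auto simp: shapes_0 top_strips_def)
  then show ?case by simp
next
  case (Suc m)
  note f = Suc.prems
  show ?case
  proof (cases "f (Suc j) < f j")
    case False
    then have "g \<notin> top_strips f j" for g
      using stripD(2)[of g f j] by (auto simp: top_strips_def)
    then have "top_strips f j = {}" by blast
    then show ?thesis using False by (simp add: principal_last_def)
  next
    case True
    define h where "h = f(j := f j - 1)"
    have h: "h \<in> shapes m" unfolding h_def by (rule remove_corner(1)[OF f True])
    let ?W = "\<lambda>g. q ^ boxes g * principal q (boxes g) g"
    have "(1 - q ^ Suc m) * principal_last q (Suc m) f j = poly (maj_last (Suc m) f j) q / poly (qpoch m) q"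
      using qpoch_nonzero[OF q, of "Suc m"] by (simp add: principal_last_def qpoch_Suc poly_monom)
    also have "\<dots> = (\<Sum>i\<le>m. (if i < j then q ^ m else 1) * principal_last q m h i)"
      using True unfolding h_def
      by (simp add: poly_sum poly_monom principal_last_def sum_divide_distrib if_distrib[of "\<lambda>p. poly p q"]
          del: fun_upd_apply cong: if_cong)
    \<comment> \<open>rows from \<open>j\<close> on have weight \<open>1 = q^m + (1 - q^m)\<close>\<close>
    also have "\<dots> = (\<Sum>i\<le>m. q ^ m * principal_last q m h i
        + (if i \<in> {j..m} then (1 - q ^ m) * principal_last q m h i else 0))"
      by (intro sum.cong) (auto simp: algebra_simps)
    also have "\<dots> = q ^ m * principal q m h + (\<Sum>i\<in>{j..m}. (1 - q ^ m) * principal_last q m h i)"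
    proof -
      have "(\<Sum>i\<le>m. if i \<in> {j..m} then (1 - q ^ m) * principal_last q m h i else 0)
         = (\<Sum>i\<in>{j..m}. (1 - q ^ m) * principal_last q m h i)"
        by (subst sum.inter_restrict[symmetric]) (auto intro!: sum.cong)
      then show ?thesis by (simp add: sum.distrib principal_eq_sum sum_distrib_left)
    qed
    also have "(\<Sum>i\<in>{j..m}. (1 - q ^ m) * principal_last q m h i) = (\<Sum>i\<in>{j..m}. \<Sum>g\<in>top_strips h i. ?W g)"
      by (intro sum.cong refl Suc.IH h)
    also have "\<dots> = sum ?W (\<Union>i\<in>{j..m}. top_strips h i)"
      by (rule sum.UNION_disjoint[symmetric])
        (use finite_top_strips[OF h] top_strips_disjoint in auto)
    also have "q ^ m * principal q m h + \<dots> = sum ?W (insert h (\<Union>i\<in>{j..m}. top_strips h i))"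
      using finite_top_strips[OF h] boxes_of_shape[OF h]
      by (subst sum.insert) (auto simp: top_strips_def)
    also have "insert h (\<Union>i\<in>{j..m}. top_strips h i) = top_strips f j"
      unfolding h_def by (rule top_strips_remove_corner[OF f True, symmetric])
    finally show ?thesis .
  qed
qed

text \<open>
  In tableau language: the variable \<open>1\<close> is treated as the largest, its boxes form a horizontal strip
  \<open>f/g\<close>, and the variables \<open>q, q\<^sup>2, \<dots>\<close> on the remaining shape \<open>g\<close> give \<open>q^|g| s\<^sub>g(1,q,q\<^sup>2,\<dots>)\<close>.
\<close>

lemma principal_rec:
  assumes q: "no_root_of_unity q" and f: "f \<in> shapes n"
  shows "principal q n f = (\<Sum>g | horizontal_strip g f. q ^ boxes g * principal q (boxes g) g)"
proof -
  let ?W = "\<lambda>g. q ^ boxes g * principal q (boxes g) g"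
  have "(1 - q ^ n) * principal q n f = (\<Sum>j\<le>n. \<Sum>g\<in>top_strips f j. ?W g)"
    unfolding principal_eq_sum[of q n f] sum_distrib_left by (intro sum.cong refl principal_last_rec[OF q f])
  also have "\<dots> = sum ?W (\<Union>j\<le>n. top_strips f j)"
    by (rule sum.UNION_disjoint[symmetric])
      (use finite_top_strips[OF f] top_strips_disjoint in auto)
  also have "?W f + \<dots> = sum ?W {g. horizontal_strip g f}"
    unfolding strips_decompose[OF f] using finite_top_strips[OF f]
    by (subst sum.insert) (auto simp: top_strips_def)
  finally show ?thesis
    using boxes_of_shape[OF f] by (simp add: algebra_simps)
qed

lemma sum_power_over_qpoch:
  assumes "no_root_of_unity q"
  shows "(\<Sum>l\<le>m. q ^ l / poly (qpoch l) q) = 1 / poly (qpoch m) q"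
proof (induction m)
  case (Suc m)
  then show ?case
    using qpoch_nonzero[OF assms, of m] qpoch_nonzero[OF assms, of "Suc m"]
    by (simp add: qpoch_Suc poly_monom field_simps)
qed simp

text \<open>
  Both sides run over pairs of a shape \<open>g\<close> and a shape interlacing with both \<open>\<nu>\<close> and \<open>g\<close>, which on the
  left is above them and on the right below; \<open>strip_exchange\<close> says that these are equally many.
\<close>

lemma principal_double_sum:
  assumes q: "no_root_of_unity q" and \<nu>: "\<nu> \<in> shapes k"
  shows "(\<Sum>f | horizontal_strip \<nu> f \<and> boxes f = k + m. principal q (k + m) f)
    = (\<Sum>\<tau> | horizontal_strip \<tau> \<nu>. \<Sum>l\<le>m. q ^ (boxes \<tau> + l) *
        (\<Sum>g | horizontal_strip \<tau> g \<and> boxes g = boxes \<tau> + l. principal q (boxes \<tau> + l) g))"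
proof -
  let ?W = "\<lambda>g. q ^ boxes g * principal q (boxes g) g"
  let ?U = "{f. horizontal_strip \<nu> f \<and> boxes f = k + m}"
  define F where "F = (\<Union>l\<le>k + m. shapes l)"
  have finF: "finite F" by (simp add: F_def finite_shapes)
  have "(\<Sum>f\<in>?U. principal q (k + m) f) = (\<Sum>f\<in>?U. \<Sum>g | g \<in> F \<and> horizontal_strip g f. ?W g)"
  proof (intro sum.cong refl)
    fix f assume "f \<in> ?U"
    then have f: "f \<in> shapes (k + m)" using shape_above[OF \<nu>] by force
    have "{g. horizontal_strip g f} = {g. g \<in> F \<and> horizontal_strip g f}"
      using shape_below[OF f] by (auto simp: F_def)
    then show "principal q (k + m) f = (\<Sum>g | g \<in> F \<and> horizontal_strip g f. ?W g)"
      using principal_rec[OF q f] by simp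
  qed
  also have "\<dots> = (\<Sum>g\<in>F. \<Sum>f | f \<in> ?U \<and> horizontal_strip g f. ?W g)"
    by (rule sum.swap_restrict) (use finF finite_strip_above[OF \<nu>] in auto)
  also have "\<dots> = (\<Sum>g\<in>F. \<Sum>\<tau> | \<tau> \<in> {\<tau>. horizontal_strip \<tau> \<nu>} \<and> horizontal_strip \<tau> g \<and> boxes g \<le> boxes \<tau> + m. ?W g)"
  proof (rule sum.cong[OF refl])
    fix g assume "g \<in> F"
    then have g: "g \<in> shapes (boxes g)" by (auto simp: F_def boxes_of_shape)
    have "card {f. f \<in> ?U \<and> horizontal_strip g f}
        = card {\<tau>. \<tau> \<in> {\<tau>. horizontal_strip \<tau> \<nu>} \<and> horizontal_strip \<tau> g \<and> boxes g \<le> boxes \<tau> + m}"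
      using strip_exchange[OF \<nu> g, of m] by (simp add: conj_ac)
    then show "(\<Sum>f | f \<in> ?U \<and> horizontal_strip g f. ?W g)
        = (\<Sum>\<tau> | \<tau> \<in> {\<tau>. horizontal_strip \<tau> \<nu>} \<and> horizontal_strip \<tau> g \<and> boxes g \<le> boxes \<tau> + m. ?W g)"
      by (simp only: sum_constant)
  qed
  also have "\<dots> = (\<Sum>\<tau> | horizontal_strip \<tau> \<nu>. \<Sum>g | g \<in> F \<and> horizontal_strip \<tau> g \<and> boxes g \<le> boxes \<tau> + m. ?W g)"
    by (rule sum.swap_restrict) (use finF finite_strip_below[OF \<nu>] in auto)
  also have "\<dots> = (\<Sum>\<tau> | horizontal_strip \<tau> \<nu>. \<Sum>l\<le>m. q ^ (boxes \<tau> + l) *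
        (\<Sum>g | horizontal_strip \<tau> g \<and> boxes g = boxes \<tau> + l. principal q (boxes \<tau> + l) g))"
  proof (intro sum.cong refl)
    fix \<tau> assume "\<tau> \<in> {\<tau>. horizontal_strip \<tau> \<nu>}"
    then have \<tau>: "\<tau> \<in> shapes (boxes \<tau>)" "boxes \<tau> \<le> k"
      using shape_below[OF \<nu>] by auto
    have "{g. g \<in> F \<and> horizontal_strip \<tau> g \<and> boxes g \<le> boxes \<tau> + m}
        = (\<Union>l\<le>m. {g. horizontal_strip \<tau> g \<and> boxes g = boxes \<tau> + l})"
    proof (intro equalityI subsetI)
      fix g assume "g \<in> {g. g \<in> F \<and> horizontal_strip \<tau> g \<and> boxes g \<le> boxes \<tau> + m}"
      then show "g \<in> (\<Union>l\<le>m. {g. horizontal_strip \<tau> g \<and> boxes g = boxes \<tau> + l})"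
        using shape_above(2)[OF \<tau>(1), of g] by (auto intro!: bexI[of _ "boxes g - boxes \<tau>"])
    next
      fix g assume "g \<in> (\<Union>l\<le>m. {g. horizontal_strip \<tau> g \<and> boxes g = boxes \<tau> + l})"
      then obtain l where l: "l \<le> m" "horizontal_strip \<tau> g" "boxes g = boxes \<tau> + l" by auto
      then have "g \<in> shapes (boxes \<tau> + l)" using shape_above(1)[OF \<tau>(1) l(2)] by simp
      then have "g \<in> F" using l(1) \<tau>(2) by (auto simp: F_def)
      then show "g \<in> {g. g \<in> F \<and> horizontal_strip \<tau> g \<and> boxes g \<le> boxes \<tau> + m}" using l by simp
    qed
    then have "(\<Sum>g | g \<in> F \<and> horizontal_strip \<tau> g \<and> boxes g \<le> boxes \<tau> + m. ?W g)
       = (\<Sum>l\<le>m. \<Sum>g | horizontal_strip \<tau> g \<and> boxes g = boxes \<tau> + l. ?W g)"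
      by (simp only:) (rule sum.UNION_disjoint, use finite_strip_above[OF \<tau>(1)] in auto)
    then show "(\<Sum>g | g \<in> F \<and> horizontal_strip \<tau> g \<and> boxes g \<le> boxes \<tau> + m. ?W g)
       = (\<Sum>l\<le>m. q ^ (boxes \<tau> + l) *
        (\<Sum>g | horizontal_strip \<tau> g \<and> boxes g = boxes \<tau> + l. principal q (boxes \<tau> + l) g))"
      by (simp add: sum_distrib_left)
  qed
  finally show ?thesis .
qed

text \<open>
  Expanding the left hand side by \<open>principal_double_sum\<close> expresses it through sums of the same kind.
  All of these are smaller, except for the summand with \<open>\<tau> = \<nu>\<close> and \<open>l = m\<close>, which is \<open>q^(k + m)\<close> times
  the sum itself. The right hand side satisfies the same relation, by \<open>principal_rec\<close> and
  \<open>sum_power_over_qpoch\<close>, so the difference \<open>D\<close> of the two sides is equal to \<open>q^(k + m) D\<close>.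
\<close>

lemma principal_pieri:
  assumes q: "no_root_of_unity q" and "\<nu> \<in> shapes k"
  shows "(\<Sum>f | horizontal_strip \<nu> f \<and> boxes f = k + m. principal q (k + m) f) = principal q k \<nu> / poly (qpoch m) q"
  using assms(2)
proof (induction "k + m" arbitrary: k m \<nu> rule: less_induct)
  case less
  note \<nu> = less.prems
  show ?case
  proof (cases "m = 0")
    case True
    have "{f. horizontal_strip \<nu> f \<and> boxes f = k} = {\<nu>}"
      using shape_above(1)[OF \<nu>] shape_below_eq strip_refl[OF \<nu>] boxes_of_shape[OF \<nu>] by fastforce
    then show ?thesis using True by simp
  next
    case False
    define L where "L \<tau> l = (\<Sum>g | horizontal_strip \<tau> g \<and> boxes g = boxes \<tau> + l. principal q (boxes \<tau> + l) g)" for \<tau> l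
    define D where "D \<tau> l = L \<tau> l - principal q (boxes \<tau>) \<tau> / poly (qpoch l) q" for \<tau> l
    \<comment> \<open>the induction hypothesis, for all but one of the summands\<close>
    have D0: "D \<tau> l = 0" if "horizontal_strip \<tau> \<nu>" "l \<le> m" "\<tau> \<noteq> \<nu> \<or> l \<noteq> m" for \<tau> l
    proof -
      have \<tau>: "\<tau> \<in> shapes (boxes \<tau>)" "boxes \<tau> \<le> k" using shape_below[OF \<nu> that(1)] by auto
      have "boxes \<tau> + l < k + m"
        using \<tau>(2) that shape_below_eq[OF \<nu> that(1)] by linarith
      then show ?thesis using less.hyps[OF _ \<tau>(1), of l] by (simp add: D_def L_def)
    qed
    have "(\<Sum>\<tau> | horizontal_strip \<tau> \<nu>. \<Sum>l\<le>m. q ^ (boxes \<tau> + l) * (principal q (boxes \<tau>) \<tau> / poly (qpoch l) q))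
        = (\<Sum>\<tau> | horizontal_strip \<tau> \<nu>. q ^ boxes \<tau> * principal q (boxes \<tau>) \<tau>) * (\<Sum>l\<le>m. q ^ l / poly (qpoch l) q)"
      unfolding sum_product by (intro sum.cong refl) (simp add: power_add)
    also have "\<dots> = principal q k \<nu> / poly (qpoch m) q"
      using principal_rec[OF q \<nu>] sum_power_over_qpoch[OF q, of m] by simp
    finally have 1: "(\<Sum>\<tau> | horizontal_strip \<tau> \<nu>. \<Sum>l\<le>m. q ^ (boxes \<tau> + l) * (principal q (boxes \<tau>) \<tau> / poly (qpoch l) q))
        = principal q k \<nu> / poly (qpoch m) q" .
    have bk: "boxes \<nu> = k" by (rule boxes_of_shape[OF \<nu>])
    have "D \<nu> m = (\<Sum>\<tau> | horizontal_strip \<tau> \<nu>. \<Sum>l\<le>m. q ^ (boxes \<tau> + l) * L \<tau> l)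
        - (\<Sum>\<tau> | horizontal_strip \<tau> \<nu>. \<Sum>l\<le>m. q ^ (boxes \<tau> + l) * (principal q (boxes \<tau>) \<tau> / poly (qpoch l) q))"
      unfolding 1 using principal_double_sum[OF q \<nu>, of m] by (simp add: D_def L_def bk)
    also have "\<dots> = (\<Sum>\<tau> | horizontal_strip \<tau> \<nu>. \<Sum>l\<le>m. q ^ (boxes \<tau> + l) * D \<tau> l)"
      by (simp add: D_def sum_subtractf right_diff_distrib)
    also have "\<dots> = (\<Sum>\<tau> | horizontal_strip \<tau> \<nu>. if \<tau> = \<nu> then q ^ (k + m) * D \<nu> m else 0)"
    proof (intro sum.cong refl)
      fix \<tau> assume "\<tau> \<in> {\<tau>. horizontal_strip \<tau> \<nu>}"
      then have s: "horizontal_strip \<tau> \<nu>" by simp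
      have "(\<Sum>l\<le>m. q ^ (boxes \<tau> + l) * D \<tau> l)
          = (\<Sum>l\<le>m. if l = m then if \<tau> = \<nu> then q ^ (k + m) * D \<nu> m else 0 else 0)"
        by (rule sum.cong[OF refl]) (use D0[OF s] bk in auto)
      then show "(\<Sum>l\<le>m. q ^ (boxes \<tau> + l) * D \<tau> l) = (if \<tau> = \<nu> then q ^ (k + m) * D \<nu> m else 0)"
        by simp
    qed
    also have "\<dots> = q ^ (k + m) * D \<nu> m"
      using strip_refl[OF \<nu>] finite_strip_below[OF \<nu>] by simp
    finally have "(1 - q ^ (k + m)) * D \<nu> m = 0" by (simp add: algebra_simps)
    moreover have "q ^ (k + m) \<noteq> 1" using q False by (auto simp: no_root_of_unity_def)
    ultimately have "D \<nu> m = 0" by simp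
    then show ?thesis by (simp add: D_def L_def bk)
  qed
qed

section \<open>Peeling the largest entry off a tableau\<close>

definition diagram :: "(nat \<Rightarrow> nat) \<Rightarrow> (nat \<times> nat) set" where
  "diagram f = {(i, j). j < f i}"

text \<open>
  The tableaux counted by the coefficient of \<open>x^m\<close> in \<open>s\<^sub>f\<close>.
\<close>

definition tableaux :: "(nat \<Rightarrow> nat) \<Rightarrow> nat multiset \<Rightarrow> (nat \<times> nat \<Rightarrow> nat) set" where
  "tableaux f m = {T \<in> extensional (diagram f).
     (\<forall>i j k. j < k \<and> k < f i \<longrightarrow> T (i, j) \<le> T (i, k)) \<and>
     (\<forall>i j k. i < k \<and> j < f k \<longrightarrow> T (i, j) < T (k, j)) \<and>
     image_mset T (mset_set (diagram f)) = m}"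

lemma diagram_Sigma: "f \<in> shapes n \<Longrightarrow> diagram f = (SIGMA i:{..<n}. {..<f i})"
proof -
  assume f: "f \<in> shapes n"
  have "i < n" if "j < f i" for i j
    using shapes_row_zero[OF f, of i] that by (cases "i < n") auto
  then show ?thesis by (auto simp: diagram_def)
qed

lemma finite_diagram: "f \<in> shapes n \<Longrightarrow> finite (diagram f)"
  by (simp add: diagram_Sigma)

lemma card_diagram: "f \<in> shapes n \<Longrightarrow> card (diagram f) = n"
  by (simp add: diagram_Sigma shapes_sum)

lemma finite_tableaux:
  assumes "f \<in> shapes n"
  shows "finite (tableaux f m)"
proof (rule finite_subset)
  show "tableaux f m \<subseteq> diagram f \<rightarrow>\<^sub>E set_mset m"
    using finite_diagram[OF assms] by (auto simp: tableaux_def PiE_def)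
  show "finite (diagram f \<rightarrow>\<^sub>E set_mset m)"
    by (simp add: finite_PiE finite_diagram[OF assms])
qed

lemma tableau_entry:
  assumes "f \<in> shapes n" "T \<in> tableaux f m" "j < f i"
  shows "T (i, j) \<in># m"
proof -
  have "(i, j) \<in># mset_set (diagram f)"
    using assms(3) finite_diagram[OF assms(1)] by (simp add: diagram_def)
  then have "T (i, j) \<in># image_mset T (mset_set (diagram f))"
    unfolding set_image_mset by (rule imageI)
  moreover have "image_mset T (mset_set (diagram f)) = m"
    using assms(2) by (simp only: tableaux_def mem_Collect_eq)
  ultimately show ?thesis by (simp only:)
qed

lemma down_closed_eq_lessThan:
  fixes A :: "nat set"
  assumes "finite A" "\<And>j k. k \<in> A \<Longrightarrow> j < k \<Longrightarrow> j \<in> A"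
  shows "A = {..<card A}"
proof -
  have "\<exists>b. b \<notin> A" using ex_new_if_finite[OF infinite_UNIV_nat assms(1)] .
  then obtain b where b: "b \<notin> A" "\<forall>i<b. \<not> i \<notin> A"
    unfolding exists_least_iff[of "\<lambda>b. b \<notin> A"] by blast
  have "x < b" if "x \<in> A" for x
    using that assms(2)[of x b] b(1) by (metis linorder_neqE_nat)
  then have "A = {..<b}" using b(2) by blast
  then show ?thesis by simp
qed

text \<open>
The shape of the part of \<open>T\<close> with entries below \<open>N\<close>.
\<close>

definition below_shape :: "nat \<Rightarrow> (nat \<Rightarrow> nat) \<Rightarrow> (nat \<times> nat \<Rightarrow> nat) \<Rightarrow> nat \<Rightarrow> nat" where
  "below_shape N f T i = card {j. j < f i \<and> T (i, j) < N}"

definition fill :: "nat \<Rightarrow> (nat \<Rightarrow> nat) \<Rightarrow> (nat \<Rightarrow> nat) \<Rightarrow> (nat \<times> nat \<Rightarrow> nat) \<Rightarrow> nat \<times> nat \<Rightarrow> nat" where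
  "fill N f g T = (\<lambda>c\<in>diagram f. if c \<in> diagram g then T c else N)"

lemma below_shape_iff:
  assumes "T \<in> tableaux f m"
  shows "j < below_shape N f T i \<longleftrightarrow> j < f i \<and> T (i, j) < N"
proof -
  have rows: "j < k \<Longrightarrow> k < f i \<Longrightarrow> T (i, j) \<le> T (i, k)" for j k
    using assms by (simp add: tableaux_def)
  have "{j. j < f i \<and> T (i, j) < N} = {..<card {j. j < f i \<and> T (i, j) < N}}"
  proof (rule down_closed_eq_lessThan)
    fix j k assume "k \<in> {j. j < f i \<and> T (i, j) < N}" "j < k"
    then show "j \<in> {j. j < f i \<and> T (i, j) < N}" using rows[of j k] by simp
  qed simp
  then show ?thesis unfolding below_shape_def by (metis (mono_tags, lifting) lessThan_iff mem_Collect_eq)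
qed

text \<open>
  The entries below \<open>N\<close> fill an initial part of each row, as rows increase weakly. They reach at least
  as far as the next row of \<open>f\<close>, since the entry above an entry is strictly smaller; so the boxes
  with entry \<open>N\<close> form a horizontal strip.
\<close>

lemma peel_tableau:
  assumes f: "f \<in> shapes n" and T: "T \<in> tableaux f m" and m: "set_mset m \<subseteq> {..N}"
  defines "g \<equiv> below_shape N f T"
  shows "horizontal_strip g f" "restrict T (diagram g) \<in> tableaux g {#x \<in># m. x < N#}"
    "boxes g = size {#x \<in># m. x < N#}" "fill N f g (restrict T (diagram g)) = T"
proof -
  have ext: "T \<in> extensional (diagram f)"
    and rows: "\<And>i j k. j < k \<Longrightarrow> k < f i \<Longrightarrow> T (i, j) \<le> T (i, k)"
    and cols: "\<And>i j k. i < k \<Longrightarrow> j < f k \<Longrightarrow> T (i, j) < T (k, j)"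
    and cont: "image_mset T (mset_set (diagram f)) = m"
    using T by (auto simp: tableaux_def)
  have iff: "j < g i \<longleftrightarrow> j < f i \<and> T (i, j) < N" for i j
    unfolding g_def by (rule below_shape_iff[OF T])
  have le: "T (i, j) \<le> N" if "j < f i" for i j
    using tableau_entry[OF f T that] m by auto
  show s: "horizontal_strip g f"
    unfolding horizontal_strip_def
  proof (intro allI conjI)
    fix i
    show "g i \<le> f i" using iff[of "f i" i] by (simp add: not_less)
    show "f (Suc i) \<le> g i"
    proof (rule ccontr)
      assume "\<not> f (Suc i) \<le> g i"
      then have j: "g i < f (Suc i)" by simp
      then have "T (i, g i) < N" using cols[of i "Suc i" "g i"] le[of "g i" "Suc i"] by simp
      moreover have "g i < f i" using j shapes_antimono[OF f, of i "Suc i"] by simp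
      ultimately show False using iff[of "g i" i] by simp
    qed
  qed
  have dg: "diagram g = {c \<in> diagram f. T c < N}"
    using iff by (auto simp: diagram_def)
  have "image_mset (restrict T (diagram g)) (mset_set (diagram g))
      = image_mset T (mset_set (diagram g))"
    using finite_diagram[OF f] dg by (intro image_mset_cong) auto
  also have "\<dots> = image_mset T (filter_mset (\<lambda>c. T c < N) (mset_set (diagram f)))"
    using finite_diagram[OF f] dg by (simp add: filter_mset_mset_set)
  also have "\<dots> = filter_mset (\<lambda>x. x < N) (image_mset T (mset_set (diagram f)))"
    by (simp add: filter_mset_image_mset)
  finally have cont': "image_mset (restrict T (diagram g)) (mset_set (diagram g)) = {#x \<in># m. x < N#}"
    by (simp only: cont)
  show t: "restrict T (diagram g) \<in> tableaux g {#x \<in># m. x < N#}"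
    unfolding tableaux_def mem_Collect_eq
  proof (intro conjI allI impI)
    fix i j k assume "j < k \<and> k < g i"
    then show "restrict T (diagram g) (i, j) \<le> restrict T (diagram g) (i, k)"
      using iff[of k i] rows[of j k i] by (simp add: diagram_def)
  next
    fix i j k assume a: "i < k \<and> j < g k"
    then have "j < f i" using iff[of j k] shapes_antimono[OF f, of i k] by simp
    then have "j < g i" using a iff[of j k] iff[of j i] cols[of i k j] by simp
    then show "restrict T (diagram g) (i, j) < restrict T (diagram g) (k, j)"
      using a iff cols by (auto simp: diagram_def)
  qed (use cont' in simp_all)
  have "size (image_mset (restrict T (diagram g)) (mset_set (diagram g))) = boxes g"
    using card_diagram[OF shape_below(1)[OF f s]] by simp
  then show "boxes g = size {#x \<in># m. x < N#}" unfolding cont' by simp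
  show "fill N f g (restrict T (diagram g)) = T"
  proof
    fix c
    show "fill N f g (restrict T (diagram g)) c = T c"
    proof (cases "c \<in> diagram f")
      case False
      then show ?thesis using extensional_arb[OF ext] by (simp add: fill_def)
    next
      case True
      then show ?thesis using iff le by (cases c) (force simp: fill_def diagram_def)
    qed
  qed
qed

lemma fill_tableau:
  assumes f: "f \<in> shapes (size m)" and m: "set_mset m \<subseteq> {..N}"
    and s: "horizontal_strip g f" and T: "T \<in> tableaux g {#x \<in># m. x < N#}"
  shows "fill N f g T \<in> tableaux f m" "below_shape N f (fill N f g T) = g"
    "restrict (fill N f g T) (diagram g) = T"
proof -
  let ?m = "{#x \<in># m. x < N#}" and ?F = "fill N f g T"
  have g: "g \<in> shapes (boxes g)" by (rule shape_below(1)[OF f s])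
  have ext: "T \<in> extensional (diagram g)"
    and rows: "\<And>i j k. j < k \<Longrightarrow> k < g i \<Longrightarrow> T (i, j) \<le> T (i, k)"
    and cols: "\<And>i j k. i < k \<Longrightarrow> j < g k \<Longrightarrow> T (i, j) < T (k, j)"
    and cont: "image_mset T (mset_set (diagram g)) = ?m"
    using T by (auto simp: tableaux_def)
  have lt: "T (i, j) < N" if "j < g i" for i j
    using tableau_entry[OF g T that] by simp
  have sub: "diagram g \<subseteq> diagram f"
    using stripD(1)[OF s] by (auto simp: diagram_def intro: less_le_trans)
  have F: "?F (i, j) = (if j < g i then T (i, j) else N)" if "j < f i" for i j
    using that by (simp add: fill_def diagram_def)
  have gf: "j < g i \<Longrightarrow> j < f i" for i j
    using stripD(1)[OF s, of i] by simp
  have "image_mset ?F (mset_set (diagram f))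
      = image_mset ?F (mset_set (diagram g)) + image_mset ?F (mset_set (diagram f - diagram g))"
    using sub finite_diagram[OF f] mset_set_Union[of "diagram g" "diagram f - diagram g"]
    by (simp add: finite_subset Un_absorb1)
  also have "image_mset ?F (mset_set (diagram g)) = image_mset T (mset_set (diagram g))"
    using sub finite_diagram[OF g] by (intro image_mset_cong) (auto simp: fill_def)
  also have "image_mset ?F (mset_set (diagram f - diagram g))
      = image_mset (\<lambda>_. N) (mset_set (diagram f - diagram g))"
    using finite_diagram[OF f] by (intro image_mset_cong) (auto simp: fill_def)
  also have "\<dots> = replicate_mset (card (diagram f - diagram g)) N"
    by (simp add: image_mset_const_eq)
  also have "card (diagram f - diagram g) = size m - size ?m"
  proof -
    have "size (image_mset T (mset_set (diagram g))) = card (diagram g)" by simp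
    then have "card (diagram g) = size ?m" unfolding cont by simp
    then show ?thesis
      using card_Diff_subset[OF finite_diagram[OF g] sub] card_diagram[OF f] by simp
  qed
  also have "image_mset T (mset_set (diagram g)) + replicate_mset (size m - size ?m) N = m"
  proof -
    have "x = N" if "x \<in># {#x \<in># m. \<not> x < N#}" for x using that m by force
    then have "{#x \<in># m. \<not> x < N#} = replicate_mset (size {#x \<in># m. \<not> x < N#}) N"
      by (metis set_mset_subset_singletonD subsetI singletonI)
    moreover have "m = ?m + {#x \<in># m. \<not> x < N#}" by (rule multiset_partition)
    ultimately show ?thesis unfolding cont by (metis add_diff_cancel_left' size_union)
  qed
  finally have contF: "image_mset ?F (mset_set (diagram f)) = m" .
  show FT: "?F \<in> tableaux f m"
    unfolding tableaux_def mem_Collect_eq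
  proof (intro conjI allI impI)
    show "?F \<in> extensional (diagram f)" by (simp add: fill_def)
  next
    fix i j k assume a: "j < k \<and> k < f i"
    show "?F (i, j) \<le> ?F (i, k)"
      using a F[of j i] F[of k i] rows[of j k i] lt[of j i] by (auto simp: less_imp_le)
  next
    fix i j k assume a: "i < k \<and> j < f k"
    then have "f k \<le> g i" using shapes_antimono[OF f, of "Suc i" k] stripD(2)[OF s, of i] by simp
    then have "j < g i" using a by simp
    then show "?F (i, j) < ?F (k, j)"
      using a F[of j i] F[of j k] cols[of i k j] lt[of j i] gf[of j i] by auto
  qed (rule contF)
  show "below_shape N f ?F = g"
  proof
    fix i
    have "j < below_shape N f ?F i \<longleftrightarrow> j < g i" for j
      using below_shape_iff[OF FT, of j N i] F[of j i] lt[of j i] gf[of j i]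
      by (auto split: if_splits)
    then show "below_shape N f ?F i = g i" by (meson linorder_neqE_nat less_irrefl)
  qed
  show "restrict ?F (diagram g) = T"
    using ext sub by (auto simp: fill_def restrict_def extensional_def fun_eq_iff)
qed

text \<open>
  The recursion for Kostka numbers: the boxes with the largest entry form a horizontal strip.
\<close>

lemma card_tableaux_peel:
  assumes f: "f \<in> shapes (size m)" and m: "set_mset m \<subseteq> {..N}"
  defines "m' \<equiv> {#x \<in># m. x < N#}"
  shows "card (tableaux f m) = (\<Sum>g | horizontal_strip g f \<and> boxes g = size m'. card (tableaux g m'))"
proof -
  let ?G = "{g. horizontal_strip g f \<and> boxes g = size m'}"
  have "bij_betw (\<lambda>T. (below_shape N f T, restrict T (diagram (below_shape N f T))))
     (tableaux f m) (SIGMA g:?G. tableaux g m')"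
  proof (rule bij_betw_byWitness[where f' = "\<lambda>(g, T). fill N f g T"])
    show "\<forall>T\<in>tableaux f m. (\<lambda>(g, T). fill N f g T)
        (below_shape N f T, restrict T (diagram (below_shape N f T))) = T"
      using peel_tableau(4)[OF f _ m] by simp
    show "\<forall>p\<in>(SIGMA g:?G. tableaux g m').
        (below_shape N f ((\<lambda>(g, T). fill N f g T) p),
         restrict ((\<lambda>(g, T). fill N f g T) p) (diagram (below_shape N f ((\<lambda>(g, T). fill N f g T) p)))) = p"
      using fill_tableau(2,3)[OF f m] unfolding m'_def by auto
    show "(\<lambda>T. (below_shape N f T, restrict T (diagram (below_shape N f T)))) ` tableaux f m
        \<subseteq> (SIGMA g:?G. tableaux g m')"
      using peel_tableau(1-3)[OF f _ m] unfolding m'_def by auto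
    show "(\<lambda>(g, T). fill N f g T) ` (SIGMA g:?G. tableaux g m') \<subseteq> tableaux f m"
      using fill_tableau(1)[OF f m] unfolding m'_def by auto
  qed
  then have "card (tableaux f m) = card (SIGMA g:?G. tableaux g m')"
    by (rule bij_betw_same_card)
  also have "\<dots> = (\<Sum>g\<in>?G. card (tableaux g m'))"
    using finite_strip_below[OF f] finite_tableaux shape_below(1)[OF f]
    by (intro card_SigmaI) (auto intro: finite_subset[of ?G "{g. horizontal_strip g f}"])
  finally show ?thesis .
qed

lemma tableaux_empty: "tableaux (\<lambda>_. 0) {#} = {\<lambda>_. undefined}"
  by (auto simp: tableaux_def diagram_def extensional_def)

text \<open>
  Peeling the largest entry \<open>N\<close> off every tableau and summing over the outer shape first, the Pieri
  rule contributes the factor \<open>1 / (q;q)\<^sub>c\<close> with \<open>c\<close> the multiplicity of \<open>N\<close>.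
\<close>

lemma sum_tableaux_principal:
  assumes q: "no_root_of_unity q" and "set_mset m \<subseteq> {..<N}"
  shows "(\<Sum>f\<in>shapes (size m). of_nat (card (tableaux f m)) * principal q (size m) f)
    = 1 / poly (\<Prod>i<N. qpoch (count m i)) q"
  using assms(2)
proof (induction N arbitrary: m)
  case 0
  then have "m = {#}" by simp
  then show ?case by (simp add: shapes_0 tableaux_empty principal_def maj_poly_def)
next
  case (Suc N)
  define m' where "m' = {#x \<in># m. x < N#}"
  define c where "c = count m N"
  have mN: "set_mset m \<subseteq> {..N}" using Suc.prems by (simp add: lessThan_Suc_atMost)
  have part: "m = m' + replicate_mset c N"
    by (rule multiset_eqI) (use mN in \<open>auto simp: m'_def c_def not_in_iff[symmetric]\<close>)
  have sz: "size m = size m' + c" using arg_cong[OF part, of size] by simp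
  have "(\<Sum>f\<in>shapes (size m). of_nat (card (tableaux f m)) * principal q (size m) f)
      = (\<Sum>f\<in>shapes (size m). \<Sum>g | g \<in> shapes (size m') \<and> horizontal_strip g f.
           of_nat (card (tableaux g m')) * principal q (size m) f)"
  proof (rule sum.cong[OF refl])
    fix f assume f: "f \<in> shapes (size m)"
    have "{g. horizontal_strip g f \<and> boxes g = size m'} = {g. g \<in> shapes (size m') \<and> horizontal_strip g f}"
      using shape_below(1)[OF f] boxes_of_shape by metis
    then show "of_nat (card (tableaux f m)) * principal q (size m) f
      = (\<Sum>g | g \<in> shapes (size m') \<and> horizontal_strip g f. of_nat (card (tableaux g m')) * principal q (size m) f)"
      using card_tableaux_peel[OF f mN] by (simp add: m'_def sum_distrib_right)
  qed
  also have "\<dots> = (\<Sum>g\<in>shapes (size m'). \<Sum>f | f \<in> shapes (size m) \<and> horizontal_strip g f.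
           of_nat (card (tableaux g m')) * principal q (size m) f)"
    by (rule sum.swap_restrict) (simp_all add: finite_shapes)
  also have "\<dots> = (\<Sum>g\<in>shapes (size m'). of_nat (card (tableaux g m')) * principal q (size m') g / poly (qpoch c) q)"
  proof (rule sum.cong[OF refl])
    fix g assume g: "g \<in> shapes (size m')"
    have "{f. f \<in> shapes (size m) \<and> horizontal_strip g f} = {f. horizontal_strip g f \<and> boxes f = size m' + c}"
      using shape_above(1)[OF g] boxes_of_shape sz by metis
    then have "(\<Sum>f | f \<in> shapes (size m) \<and> horizontal_strip g f. principal q (size m) f) = principal q (size m') g / poly (qpoch c) q"
      using principal_pieri[OF q g, of c] by (simp add: sz)
    then show "(\<Sum>f | f \<in> shapes (size m) \<and> horizontal_strip g f. of_nat (card (tableaux g m')) * principal q (size m) f)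
      = of_nat (card (tableaux g m')) * principal q (size m') g / poly (qpoch c) q"
      by (simp flip: sum_distrib_left)
  qed
  also have "\<dots> = 1 / poly (\<Prod>i<N. qpoch (count m' i)) q / poly (qpoch c) q"
    unfolding sum_divide_distrib[symmetric]
    by (subst Suc.IH) (auto simp: m'_def)
  also have "(\<Prod>i<N. qpoch (count m' i)) = (\<Prod>i<N. qpoch (count m i))"
    by (intro prod.cong) (auto simp: m'_def)
  finally show ?case by (simp add: c_def)
qed

text \<open>
  Both sides are polynomials in \<open>q\<close>, and they agree at all real \<open>q\<close> between \<open>0\<close> and \<open>1\<close>. As a
  polynomial identity it can be used at roots of unity, where \<open>(q;q)\<^sub>n\<close> may vanish.
\<close>

lemma sum_tableaux_maj_poly:
  assumes "set_mset m \<subseteq> {..<N}"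
  shows "(\<Sum>f\<in>shapes (size m). smult (of_nat (card (tableaux f m))) (maj_poly (size m) f))
    * (\<Prod>i<N. qpoch (count m i)) = qpoch (size m)"
proof -
  let ?K = "\<Sum>f\<in>shapes (size m). smult (of_nat (card (tableaux f m))) (maj_poly (size m) f)"
  let ?Q = "\<Prod>i<N. qpoch (count m i)"
  define P where "P = ?K * ?Q - qpoch (size m)"
  have "poly P q = 0" if q: "no_root_of_unity q" for q
  proof -
    have "poly ?K q / poly (qpoch (size m)) q
        = (\<Sum>f\<in>shapes (size m). of_nat (card (tableaux f m)) * principal q (size m) f)"
      by (simp add: poly_sum principal_def sum_divide_distrib)
    also have "\<dots> = 1 / poly ?Q q" by (rule sum_tableaux_principal[OF q assms])
    finally show ?thesis
      using qpoch_nonzero[OF q] by (simp add: P_def poly_prod field_simps)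
  qed
  then have "{q. no_root_of_unity q} \<subseteq> {q. poly P q = 0}" by blast
  moreover have "infinite {q. no_root_of_unity q}"
  proof
    assume "finite {q. no_root_of_unity q}"
    moreover have "complex_of_real ` {0<..<1} \<subseteq> {q. no_root_of_unity q}"
    proof safe
      fix x :: real assume x: "x \<in> {0<..<1}"
      have "complex_of_real x ^ k \<noteq> 1" if "k \<ge> 1" for k
      proof -
        have "x ^ k < 1" using x that by (simp add: power_less_one_iff)
        then show ?thesis by (simp flip: of_real_power)
      qed
      then show "no_root_of_unity (complex_of_real x)" by (simp add: no_root_of_unity_def)
    qed
    ultimately have "finite (complex_of_real ` {0<..<1})" by (rule finite_subset[rotated])
    then have "finite {0<..<1::real}" by (rule finite_imageD) (simp add: inj_on_def)
    then show False using infinite_Ioo[of 0 "1::real"] by simp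
  qed
  ultimately have "P = 0" using poly_roots_finite[of P] finite_subset by blast
  then show ?thesis by (simp add: P_def)
qed

section \<open>Powers of power sums at roots of unity\<close>

definition primitive_root_of_unity :: "nat \<Rightarrow> complex \<Rightarrow> bool" where
  "primitive_root_of_unity d z \<longleftrightarrow> d \<ge> 1 \<and> (\<forall>k. z ^ k = 1 \<longleftrightarrow> d dvd k)"

text \<open>
  What remains of \<open>(q;q)\<^sub>m\<close> after dividing out \<open>1 - q^d\<close> once for each multiple of \<open>d\<close> up to \<open>m\<close>.
\<close>

definition qpoch_cofactor :: "nat \<Rightarrow> nat \<Rightarrow> complex poly" where
  "qpoch_cofactor d m = (\<Prod>k=1..m. if d dvd k then \<Sum>s<k div d. monom 1 d ^ s else 1 - monom 1 k)"

lemma qpoch_factor: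
  assumes "d \<ge> 1"
  shows "qpoch m = (1 - monom 1 d) ^ (m div d) * qpoch_cofactor d m"
proof (induction m)
  case 0
  then show ?case by (simp add: qpoch_cofactor_def)
next
  case (Suc m)
  show ?case
  proof (cases "d dvd Suc m")
    case True
    then have "(1 - monom 1 (Suc m) :: complex poly) = (1 - monom 1 d) * (\<Sum>s<Suc m div d. monom 1 d ^ s)"
      by (subst one_diff_power_eq[symmetric]) (simp add: monom_power)
    moreover have "Suc m div d = Suc (m div d)" using True by (simp add: div_Suc dvd_eq_mod_eq_0)
    ultimately show ?thesis using True Suc.IH by (simp add: qpoch_Suc qpoch_cofactor_def mult_ac)
  next
    case False
    then have "Suc m div d = m div d" by (simp add: div_Suc dvd_eq_mod_eq_0)
    then show ?thesis using False Suc.IH by (simp add: qpoch_Suc qpoch_cofactor_def mult_ac)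
  qed
qed

lemma poly_qpoch_cofactor:
  assumes "primitive_root_of_unity d z"
  shows "poly (qpoch_cofactor d m) z = (\<Prod>k=1..m. if d dvd k then of_nat (k div d) else 1 - z ^ k)"
  unfolding qpoch_cofactor_def poly_prod
proof (intro prod.cong refl)
  fix k
  have "z ^ d = 1" using assms by (simp add: primitive_root_of_unity_def)
  then show "poly (if d dvd k then \<Sum>s<k div d. monom 1 d ^ s else 1 - monom 1 k) z
      = (if d dvd k then of_nat (k div d) else 1 - z ^ k)"
    by (simp add: poly_sum poly_monom)
qed

lemma qpoch_cofactor_nonzero:
  assumes z: "primitive_root_of_unity d z"
  shows "poly (qpoch_cofactor d m) z \<noteq> 0"
proof -
  have "(if d dvd k then of_nat (k div d) else 1 - z ^ k) \<noteq> 0" if "k \<in> {1..m}" for k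
    using that z by (auto simp: primitive_root_of_unity_def dvd_def)
  then show ?thesis unfolding poly_qpoch_cofactor[OF z] by (simp only: prod_zero_iff finite_atLeastAtMost) blast
qed

lemma qpoch_cofactor_multiple:
  assumes z: "primitive_root_of_unity d z"
  shows "poly (qpoch_cofactor d (d * k)) z = fact k * (\<Prod>s=1..<d. 1 - z ^ s) ^ k"
proof (induction k)
  case 0
  then show ?case by (simp add: qpoch_cofactor_def)
next
  case (Suc k)
  have d: "d \<ge> 1" and zd: "z ^ d = 1" using z by (auto simp: primitive_root_of_unity_def)
  let ?h = "\<lambda>k. if d dvd k then of_nat (k div d) else 1 - z ^ k"
  have "(\<Prod>i=1..d * Suc k. ?h i) = (\<Prod>i=1..d * k. ?h i) * (\<Prod>i=d * k + 1..d * k + d. ?h i)"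
    using prod.ub_add_nat[of 1 "d * k" ?h d] by (simp add: add.commute)
  also have "(\<Prod>i=d * k + 1..d * k + d. ?h i) = (\<Prod>s=1..d. ?h (s + d * k))"
    using prod.shift_bounds_cl_nat_ivl[of ?h 1 "d * k" d] by (simp add: add.commute)
  also have "\<dots> = (\<Prod>s\<in>insert d {1..<d}. ?h (s + d * k))"
    using d by (intro prod.cong) auto
  also have "\<dots> = of_nat (Suc k) * (\<Prod>s=1..<d. ?h (s + d * k))"
    using d by (subst prod.insert) auto
  also have "(\<Prod>s=1..<d. ?h (s + d * k)) = (\<Prod>s=1..<d. 1 - z ^ s)"
  proof (intro prod.cong refl)
    fix s assume s: "s \<in> {1..<d}"
    then have "\<not> d dvd s" using dvd_imp_le[of d s] by auto
    then have "\<not> d dvd s + d * k" by (simp add: dvd_add_left_iff)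
    then show "?h (s + d * k) = 1 - z ^ s" using zd by (simp add: power_add power_mult)
  qed
  finally show ?case
    using Suc.IH unfolding poly_qpoch_cofactor[OF z] by (simp add: algebra_simps)
qed

lemma size_eq_sum_count:
  fixes m :: "nat multiset"
  shows "set_mset m \<subseteq> {..<N} \<Longrightarrow> size m = (\<Sum>i<N. count m i)"
  unfolding size_multiset_overloaded_eq
  by (rule sum.mono_neutral_left) (auto simp: not_in_iff)

text \<open>
  In the identity \<open>sum_tableaux_maj_poly\<close>, the factor \<open>1 - q^d\<close> occurs \<open>e = \<Sum>\<^sub>i \<lfloor>m\<^sub>i/d\<rfloor>\<close> times on the left
  and \<open>k = |m|/d\<close> times on the right. After cancelling, \<open>k - e\<close> of them remain on the right, and they
  vanish at \<open>z\<close> unless \<open>e = k\<close>, that is, unless \<open>d\<close> divides every \<open>m\<^sub>i\<close>. In that case the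
  cofactors are evaluated by \<open>qpoch_cofactor_multiple\<close>.
\<close>

lemma sum_tableaux_maj_poly_root:
  fixes m :: "nat multiset"
  assumes z: "primitive_root_of_unity d z" and m: "set_mset m \<subseteq> {..<N}" and d: "d dvd size m"
  defines "M \<equiv> \<Sum>f\<in>shapes (size m). of_nat (card (tableaux f m)) * poly (maj_poly (size m) f) z"
  shows "(\<forall>i. d dvd count m i) \<Longrightarrow> M * (\<Prod>i<N. fact (count m i div d)) = fact (size m div d)"
    and "\<not> (\<forall>i. d dvd count m i) \<Longrightarrow> M = 0"
proof -
  define P where "P = (\<Sum>f\<in>shapes (size m). smult (of_nat (card (tableaux f m))) (maj_poly (size m) f))"
  define e where "e = (\<Sum>i<N. count m i div d)"
  define k where "k = size m div d"
  have M: "poly P z = M" by (simp add: P_def M_def poly_sum)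
  have d1: "d \<ge> 1" and zd: "z ^ d = 1" using z by (auto simp: primitive_root_of_unity_def)
  have sz: "d * k = (\<Sum>i<N. count m i)" using d size_eq_sum_count[OF m] by (simp add: k_def)
  have le: "d * e \<le> d * k" unfolding sz e_def sum_distrib_left by (intro sum_mono) simp
  then have ek: "e \<le> k" using d1 by simp
  have "(1 - monom 1 d) ^ e * (P * (\<Prod>i<N. qpoch_cofactor d (count m i)))
      = P * (\<Prod>i<N. qpoch (count m i))"
    by (simp add: qpoch_factor[OF d1] prod.distrib power_sum e_def mult_ac)
  also have "\<dots> = qpoch (size m)" unfolding P_def by (rule sum_tableaux_maj_poly[OF m])
  also have "\<dots> = (1 - monom 1 d) ^ e * ((1 - monom 1 d) ^ (k - e) * qpoch_cofactor d (size m))"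
    using ek by (simp add: qpoch_factor[OF d1] k_def mult.assoc[symmetric] power_add[symmetric])
  finally have eq: "(1 - monom 1 d) ^ e * (P * (\<Prod>i<N. qpoch_cofactor d (count m i)))
     = (1 - monom 1 d) ^ e * ((1 - monom 1 d) ^ (k - e) * qpoch_cofactor d (size m))" .
  \<comment> \<open>cancel before evaluating, since \<open>1 - q^d\<close> vanishes at \<open>z\<close>\<close>
  have "(1 - monom 1 d :: complex poly) \<noteq> 0"
  proof
    assume "(1 - monom 1 d :: complex poly) = 0"
    then have "poly (1 - monom 1 d :: complex poly) 0 = 0" by simp
    then show False using d1 by (simp add: poly_monom power_0_left)
  qed
  then have "P * (\<Prod>i<N. qpoch_cofactor d (count m i)) = (1 - monom 1 d) ^ (k - e) * qpoch_cofactor d (size m)"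
    using eq by simp
  from arg_cong[OF this, of "\<lambda>p. poly p z"]
  have ev: "M * (\<Prod>i<N. poly (qpoch_cofactor d (count m i)) z)
      = 0 ^ (k - e) * poly (qpoch_cofactor d (size m)) z"
    using zd by (simp add: M poly_prod poly_monom)
  show "M * (\<Prod>i<N. fact (count m i div d)) = fact (size m div d)" if dv: "\<forall>i. d dvd count m i"
  proof -
    define C where "C = (\<Prod>s=1..<d. 1 - z ^ s)"
    have C0: "C \<noteq> 0" using z by (auto simp: C_def primitive_root_of_unity_def dest: dvd_imp_le)
    have "d * e = d * k" unfolding sz e_def sum_distrib_left using dv by simp
    then have ke: "k = e" using d1 by simp
    have "poly (qpoch_cofactor d (count m i)) z = fact (count m i div d) * C ^ (count m i div d)" for i
      using qpoch_cofactor_multiple[OF z, of "count m i div d"] dv by (simp add: C_def)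
    moreover have "poly (qpoch_cofactor d (size m)) z = fact k * C ^ k"
      using qpoch_cofactor_multiple[OF z, of k] d by (simp add: C_def k_def)
    ultimately have "M * (\<Prod>i<N. fact (count m i div d)) * C ^ e = fact k * C ^ e"
      using ev by (simp add: ke prod.distrib power_sum e_def mult_ac)
    then show ?thesis using C0 by (simp add: k_def)
  qed
  show "M = 0" if ndv: "\<not> (\<forall>i. d dvd count m i)"
  proof -
    obtain i where i: "\<not> d dvd count m i" using ndv by blast
    then have "i < N" using m by (metis count_inI dvd_0_right lessThan_iff subsetD)
    moreover have "d * (count m i div d) < count m i"
      using i by (metis dvd_triv_left le_neq_implies_less times_div_less_eq_dividend)
    ultimately have "d * e < d * k"
      unfolding sz e_def sum_distrib_left by (intro sum_strict_mono_ex1) auto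
    then have "k - e > 0" by simp
    then have "M * (\<Prod>i<N. poly (qpoch_cofactor d (count m i)) z) = 0"
      using ev by (simp add: power_0_left)
    then show ?thesis using qpoch_cofactor_nonzero[OF z] by simp
  qed
qed

lemma coeff_power_sum_Suc:
  assumes d: "d \<ge> 1" and m: "set_mset m \<subseteq> {..<N}"
  shows "mps_coeff (power_sum d ^ Suc k) m
    = (\<Sum>i | i < N \<and> d \<le> count m i. mps_coeff (power_sum d ^ k) (m - replicate_mset d i))"
proof -
  let ?S = "{(a, b). a + b = m}" and ?I = "{i. i < N \<and> d \<le> count m i}"
  let ?c = "mps_coeff (power_sum d ^ k)"
  let ?g = "\<lambda>i. (replicate_mset d i, m - replicate_mset d i)"
  have "mps_coeff (power_sum d ^ Suc k) m
      = (\<Sum>(a, b)\<in>?S. (if \<exists>i. a = replicate_mset d i then 1 else 0) * ?c b)"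
    by (simp add: times_mps.rep_eq power_sum.rep_eq)
  also have "\<dots> = (\<Sum>(a, b)\<in>?g ` ?I. ?c b)"
  proof (rule sum.mono_neutral_cong_right)
    show "finite ?S" by (rule finite_multiset_splits)
    show "?g ` ?I \<subseteq> ?S"
      by (auto simp: count_le_replicate_mset_subset_eq)
    show "\<forall>p\<in>?S - ?g ` ?I. (case p of (a, b) \<Rightarrow> (if \<exists>i. a = replicate_mset d i then 1 else 0) * ?c b) = 0"
    proof
      fix p assume p: "p \<in> ?S - ?g ` ?I"
      obtain a b where ab: "p = (a, b)" by (cases p)
      have "a \<noteq> replicate_mset d i" for i
      proof
        assume a: "a = replicate_mset d i"
        have s: "m = replicate_mset d i + b" using p by (auto simp: ab a)
        then have "i \<in># m" using d by simp
        then have "i \<in> ?I" using m s by auto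
        moreover have "p = ?g i" using s by (simp add: ab a)
        ultimately show False using p by blast
      qed
      then show "(case p of (a, b) \<Rightarrow> (if \<exists>i. a = replicate_mset d i then 1 else 0) * ?c b) = 0"
        by (simp add: ab)
    qed
  qed auto
  also have "\<dots> = (\<Sum>i\<in>?I. ?c (m - replicate_mset d i))"
  proof -
    have "inj_on ?g ?I"
    proof (rule inj_onI)
      fix x y assume "?g x = ?g y"
      then have "replicate_mset d x = replicate_mset d y" by simp
      from arg_cong[OF this, of "\<lambda>M. count M x"] show "x = y"
        using d by (simp split: if_splits)
    qed
    then show ?thesis by (simp add: sum.reindex)
  qed
  finally show ?thesis .
qed

text \<open>
  The coefficient is a multinomial coefficient: a monomial of \<open>p\<^sub>d^k\<close> arises from sequences of \<open>k\<close>
  variables, each taken to the power \<open>d\<close>. Splitting off the first variable \<open>i\<close> divides the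
  product of factorials by \<open>m\<^sub>i/d\<close>, and these quotients add up to the exponent \<open>k + 1\<close>.
\<close>

lemma coeff_power_sum_power:
  fixes m :: "nat multiset"
  assumes d: "d \<ge> 1" and "set_mset m \<subseteq> {..<N}"
  shows "mps_coeff (power_sum d ^ k) m * (\<Prod>i<N. fact (count m i div d))
    = (if (\<forall>i. d dvd count m i) \<and> size m = d * k then fact k else (0 :: complex))"
  using assms(2)
proof (induction k arbitrary: m)
  case 0
  show ?case by (auto simp: one_mps.rep_eq)
next
  case (Suc k)
  let ?I = "{i. i < N \<and> d \<le> count m i}"
  let ?D = "(\<forall>i. d dvd count m i) \<and> size m = d * Suc k"
  have "mps_coeff (power_sum d ^ Suc k) m * (\<Prod>j<N. fact (count m j div d) :: complex)
      = (\<Sum>i\<in>?I. mps_coeff (power_sum d ^ k) (m - replicate_mset d i) * (\<Prod>j<N. fact (count m j div d)))"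
    unfolding coeff_power_sum_Suc[OF d Suc.prems] by (rule sum_distrib_right)
  also have "\<dots> = (\<Sum>i\<in>?I. if ?D then of_nat (count m i div d) * fact k else 0)"
  proof (rule sum.cong[OF refl])
    fix i assume i: "i \<in> ?I"
    define b where "b = m - replicate_mset d i"
    have cb: "count b j = (if j = i then count m i - d else count m j)" for j by (simp add: b_def)
    have mb: "m = b + replicate_mset d i"
      using i by (simp add: b_def count_le_replicate_mset_subset_eq)
    have div: "count m i div d = Suc (count b i div d)"
      using i d by (simp add: cb le_div_geq)
    \<comment> \<open>only the factor at \<open>i\<close> changes, from \<open>(m\<^sub>i/d - 1)!\<close> to \<open>(m\<^sub>i/d)!\<close>\<close>
    have rest: "(\<Prod>j\<in>{..<N} - {i}. fact (count m j div d)) = (\<Prod>j\<in>{..<N} - {i}. fact (count b j div d) :: complex)"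
      by (intro prod.cong) (auto simp: cb)
    have "(\<Prod>j<N. fact (count m j div d)) = fact (count m i div d) * (\<Prod>j\<in>{..<N} - {i}. fact (count m j div d) :: complex)"
      using i by (intro prod.remove) auto
    also have "\<dots> = of_nat (count m i div d) *
        (fact (count b i div d) * (\<Prod>j\<in>{..<N} - {i}. fact (count b j div d)))"
      unfolding rest div by (simp add: mult_ac)
    also have "fact (count b i div d) * (\<Prod>j\<in>{..<N} - {i}. fact (count b j div d))
        = (\<Prod>j<N. fact (count b j div d) :: complex)"
      using i by (intro prod.remove[symmetric]) auto
    finally have "mps_coeff (power_sum d ^ k) b * (\<Prod>j<N. fact (count m j div d) :: complex)
        = of_nat (count m i div d) * (mps_coeff (power_sum d ^ k) b * (\<Prod>j<N. fact (count b j div d)))"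
      by simp
    also have "mps_coeff (power_sum d ^ k) b * (\<Prod>j<N. fact (count b j div d))
        = (if (\<forall>i. d dvd count b i) \<and> size b = d * k then fact k else (0 :: complex))"
      by (rule Suc.IH) (use Suc.prems in \<open>auto simp: b_def dest: in_diffD\<close>)
    also have "((\<forall>i. d dvd count b i) \<and> size b = d * k) \<longleftrightarrow> ?D"
    proof -
      have "d dvd count b i \<longleftrightarrow> d dvd count m i" using i by (simp add: cb dvd_minus_self)
      then have "(\<forall>i. d dvd count b i) \<longleftrightarrow> (\<forall>i. d dvd count m i)" by (metis cb)
      then show ?thesis using mb by (metis add_right_cancel mult_Suc_right add.commute size_replicate_mset size_union)
    qed
    finally show "mps_coeff (power_sum d ^ k) (m - replicate_mset d i) * (\<Prod>j<N. fact (count m j div d))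
        = (if ?D then of_nat (count m i div d) * fact k else (0 :: complex))"
      by (simp add: b_def split: if_splits)
  qed
  also have "\<dots> = (if ?D then of_nat (\<Sum>i\<in>?I. count m i div d) * fact k else 0)"
  proof -
    have "(\<Sum>i\<in>?I. if P then h i else 0) = (if P then \<Sum>i\<in>?I. h i else 0)" for P and h :: "nat \<Rightarrow> complex"
      by (cases P) simp_all
    then show ?thesis unfolding of_nat_sum sum_distrib_right .
  qed
  also have "(\<Sum>i\<in>?I. count m i div d) = (\<Sum>i<N. count m i div d)"
    by (rule sum.mono_neutral_left) (auto simp: div_greater_zero_iff)
  also have "(if ?D then of_nat (\<Sum>i<N. count m i div d) * fact k else 0) = (if ?D then fact (Suc k) else (0::complex))"
  proof (rule if_cong[OF refl _ refl])
    assume D: ?D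
    have "d * (\<Sum>i<N. count m i div d) = d * Suc k"
      using D size_eq_sum_count[OF Suc.prems] by (simp add: sum_distrib_left)
    then have "(\<Sum>i<N. count m i div d) = Suc k" using d by (simp only: mult_cancel1) simp
    then show "of_nat (\<Sum>i<N. count m i div d) * fact k = (fact (Suc k) :: complex)" by (simp add: mult.commute)
  qed
  finally show ?case .
qed

lemma mps_coeff_sum: "mps_coeff (\<Sum>x\<in>A. h x) m = (\<Sum>x\<in>A. mps_coeff (h x) m)"
  by (induction A rule: infinite_finite_induct) (auto simp: zero_mps.rep_eq plus_mps.rep_eq)

definition row_lengths :: "nat list \<Rightarrow> nat \<Rightarrow> nat" where
  "row_lengths ps i = (if i < length ps then ps ! i else 0)"

lemma ssyt_eq_tableaux: "{T \<in> ssyt ps. content ps T = m} = tableaux (row_lengths ps) m"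
proof -
  have "young_diagram ps = diagram (row_lengths ps)"
    by (auto simp: young_diagram_def diagram_def row_lengths_def split: if_splits)
  then show ?thesis
    by (simp add: ssyt_def content_def tableaux_def) (auto simp: diagram_def)
qed

lemma bij_betw_row_lengths: "bij_betw row_lengths (partitions_of n) (shapes n)"
proof (rule bij_betw_imageI)
  have supp: "{i. row_lengths ps i \<noteq> 0} = {..<length ps}" if "ps \<in> partitions_of n" for ps
  proof -
    have "ps ! i \<noteq> 0" if "i < length ps" for i
    proof -
      have "0 \<notin> set ps" using \<open>ps \<in> partitions_of n\<close> by (simp add: partitions_of_def)
      then show ?thesis using nth_mem[OF that] by metis
    qed
    then show ?thesis by (auto simp: row_lengths_def)
  qed
  show "inj_on row_lengths (partitions_of n)"
  proof (rule inj_onI)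
    fix ps ps' assume a: "ps \<in> partitions_of n" "ps' \<in> partitions_of n" "row_lengths ps = row_lengths ps'"
    then have "{..<length ps} = {..<length ps'}" using supp by metis
    then have len: "length ps = length ps'" by simp
    then have "ps ! i = ps' ! i" if "i < length ps" for i
      using fun_cong[OF a(3), of i] that by (simp add: row_lengths_def)
    then show "ps = ps'" using len by (intro nth_equalityI)
  qed
  show "row_lengths ` partitions_of n = shapes n"
  proof (intro equalityI subsetI)
    fix f assume "f \<in> row_lengths ` partitions_of n"
    then obtain ps where f: "f = row_lengths ps" and ps: "ps \<in> partitions_of n" by blast
    show "f \<in> shapes n" unfolding f
    proof (rule shapesI)
      show "row_lengths ps (Suc i) \<le> row_lengths ps i" for i
      proof -
        have "sorted_wrt (\<ge>) ps" using ps by (simp add: partitions_of_def)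
        then show ?thesis
          using sorted_wrt_nth_less[of "(\<ge>)" ps i "Suc i"] by (simp add: row_lengths_def)
      qed
      show "row_lengths ps i = 0" if "i \<ge> length ps" for i using that by (simp add: row_lengths_def)
      show "sum (row_lengths ps) {..<length ps} = n"
        using ps by (simp add: row_lengths_def partitions_of_def sum_list_sum_nth atLeast0LessThan)
    qed
  next
    fix f assume f: "f \<in> shapes n"
    define L where "L = card {i. f i \<noteq> 0}"
    have L: "{i. f i \<noteq> 0} = {..<L}" unfolding L_def
    proof (rule down_closed_eq_lessThan)
      show "finite {i. f i \<noteq> 0}" using f by (simp add: shapes_def)
      fix j k assume "k \<in> {i. f i \<noteq> 0}" "j < k"
      then show "j \<in> {i. f i \<noteq> 0}" using shapes_antimono[OF f, of j k] by simp
    qed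
    then have L': "f i \<noteq> 0 \<longleftrightarrow> i < L" for i by blast
    have "row_lengths (map f [0..<L]) i = f i" for i
      using L'[of i] by (cases "i < L") (simp_all add: row_lengths_def)
    then have "row_lengths (map f [0..<L]) = f" by blast
    moreover have "map f [0..<L] \<in> partitions_of n"
    proof -
      have "sum_list (map f [0..<L]) = boxes f"
        unfolding boxes_def L by (simp add: interv_sum_list_conv_sum_set_nat atLeast0LessThan)
      moreover have "sorted_wrt (\<ge>) (map f [0..<L])"
        unfolding sorted_wrt_iff_nth_less using shapes_antimono[OF f] by simp
      moreover have "0 \<notin> set (map f [0..<L])"
      proof
        assume "0 \<in> set (map f [0..<L])"
        then obtain i where "i < L" "f i = 0" by auto
        then show False using L'[of i] by simp
      qed
      ultimately show ?thesis using boxes_of_shape[OF f] by (simp add: partitions_of_def)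
    qed
    ultimately show "f \<in> row_lengths ` partitions_of n" by (metis imageI)
  qed
qed

definition maj_gf :: "nat \<Rightarrow> nat list \<Rightarrow> complex poly" where
  "maj_gf n ps = maj_poly n (row_lengths ps)"

text \<open>
  Both sides have the same coefficients, as computed in \<open>coeff_power_sum_power\<close> and
  \<open>sum_tableaux_maj_poly_root\<close>.
\<close>

lemma power_sum_eq_sum_schur:
  assumes z: "primitive_root_of_unity d z" and dn: "d dvd n"
  shows "power_sum d ^ (n div d) = (\<Sum>ps\<in>partitions_of n. mps_smult (poly (maj_gf n ps) z) (schur ps))"
proof (rule mps_eqI)
  fix m :: "nat multiset"
  have d: "d \<ge> 1" using z by (simp add: primitive_root_of_unity_def)
  obtain N where N: "set_mset m \<subseteq> {..<N}"
    by (meson finite_nat_iff_bounded finite_set_mset)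
  have "mps_coeff (\<Sum>ps\<in>partitions_of n. mps_smult (poly (maj_gf n ps) z) (schur ps)) m
     = (\<Sum>ps\<in>partitions_of n. of_nat (card (tableaux (row_lengths ps) m)) * poly (maj_poly n (row_lengths ps)) z)"
    by (simp add: mps_coeff_sum mps_smult.rep_eq schur.rep_eq ssyt_eq_tableaux maj_gf_def mult.commute)
  also have "\<dots> = (\<Sum>f\<in>shapes n. of_nat (card (tableaux f m)) * poly (maj_poly n f) z)"
    by (rule sum.reindex_bij_betw[OF bij_betw_row_lengths])
  also have "\<dots> = mps_coeff (power_sum d ^ (n div d)) m" (is "?M = ?c")
  proof -
    let ?F = "\<Prod>i<N. fact (count m i div d) :: complex"
    have F0: "?F \<noteq> 0" by simp
    note c = coeff_power_sum_power[OF d N, of "n div d"]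
    have "?M * ?F = ?c * ?F"
    proof (cases "size m = n")
      case True
      show ?thesis
        using sum_tableaux_maj_poly_root[OF z N] dn c unfolding True
        by (cases "\<forall>i. d dvd count m i") auto
    next
      case False
      have "tableaux f m = {}" if "f \<in> shapes n" for f
      proof -
        have "size m = n" if "T \<in> tableaux f m" for T
        proof -
          have "image_mset T (mset_set (diagram f)) = m" using that by (simp add: tableaux_def)
          from arg_cong[OF this, of size] show ?thesis using card_diagram[OF \<open>f \<in> shapes n\<close>] by simp
        qed
        then show ?thesis using False by blast
      qed
      then have "?M = 0" by simp
      then show ?thesis using c False dn by simp
    qed
    then show ?thesis by (rule mult_right_cancel[OF F0, THEN iffD1])
  qed
  finally show "mps_coeff (power_sum d ^ (n div d)) m
      = mps_coeff (\<Sum>ps\<in>partitions_of n. mps_smult (poly (maj_gf n ps) z) (schur ps)) m" by simp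
qed

section \<open>Ramanujan sums as averages\<close>

definition unity :: "nat \<Rightarrow> nat \<Rightarrow> complex" where
  "unity n k = exp (2 * of_real pi * \<i> * of_nat k / of_nat n)"

definition residues_coprime :: "nat \<Rightarrow> nat set" where
  "residues_coprime d = {m. 1 \<le> m \<and> m \<le> d \<and> coprime m d}"

lemma finite_residues_coprime [simp]: "finite (residues_coprime d)"
  by (rule finite_subset[of _ "{..d}"]) (auto simp: residues_coprime_def)

lemma unity_power: "unity n k ^ r = unity n (k * r)"
  by (simp add: unity_def exp_of_nat_mult[symmetric] field_simps)

lemma unity_add: "unity n (k + l) = unity n k * unity n l"
  by (simp add: unity_def exp_add[symmetric] distrib_left add_divide_distrib)

lemma unity_eq_1_iff: "n \<ge> 1 \<Longrightarrow> unity n k = 1 \<longleftrightarrow> n dvd k"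
  unfolding unity_def by (rule complex_root_unity_eq_1)

lemma unity_mod: "n \<ge> 1 \<Longrightarrow> unity n (k mod n) = unity n k"
  unfolding unity_def by (subst complex_root_unity_eq) auto

lemma unity_cancel: "e \<ge> 1 \<Longrightarrow> unity (d * e) (m * e) = unity d m"
  by (simp add: unity_def field_simps)

lemma primitive_unity:
  assumes "d \<ge> 1" "coprime m d"
  shows "primitive_root_of_unity d (unity d m)"
  using assms by (auto simp: primitive_root_of_unity_def unity_power unity_eq_1_iff
      coprime_commute coprime_dvd_mult_right_iff)

lemma ramanujan_sum_unity: "ramanujan_sum d r = (\<Sum>m\<in>residues_coprime d. unity d m ^ r)"
  unfolding ramanujan_sum_def unity_power
  by (simp add: residues_coprime_def unity_def mult.assoc)

text \<open>
  Each fraction \<open>k/n\<close> with \<open>1 \<le> k \<le> n\<close> has a unique representation \<open>m/d\<close> in lowest terms, and the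
  denominators \<open>d\<close> are the divisors of \<open>n\<close>.
\<close>

lemma sum_lowest_terms:
  assumes "n \<ge> 1"
  shows "(\<Sum>d | d dvd n. \<Sum>m\<in>residues_coprime d. F (unity d m)) = (\<Sum>k=1..n. F (unity n k) :: complex)"
proof -
  have "finite {d. d dvd n}" using assms by simp
  then have "(\<Sum>d | d dvd n. \<Sum>m\<in>residues_coprime d. F (unity d m))
      = (\<Sum>(d, m)\<in>(SIGMA d:{d. d dvd n}. residues_coprime d). F (unity d m))"
    by (subst sum.Sigma) auto
  also have "\<dots> = (\<Sum>k=1..n. F (unity n k))"
  proof (rule sum.reindex_bij_witness
      [where i = "\<lambda>k. (n div gcd k n, k div gcd k n)" and j = "\<lambda>(d, m). m * (n div d)"])
    fix p assume "p \<in> (SIGMA d:{d. d dvd n}. residues_coprime d)"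
    then obtain d m where p: "p = (d, m)" "d dvd n" "1 \<le> m" "m \<le> d" "coprime m d"
      by (auto simp: residues_coprime_def)
    define e where "e = n div d"
    have n: "n = d * e" using p(2) by (simp add: e_def)
    have e: "e \<ge> 1" and d: "d \<ge> 1" using assms n by (cases "e = 0"; cases "d = 0"; simp)+
    have g: "gcd (m * e) n = e"
      unfolding n using p(5) by (metis coprime_imp_gcd_eq_1 gcd_mult_distrib_nat mult.commute mult_1_right)
    show "(n div gcd (case p of (d, m) \<Rightarrow> m * (n div d)) n,
        (case p of (d, m) \<Rightarrow> m * (n div d)) div gcd (case p of (d, m) \<Rightarrow> m * (n div d)) n) = p"
      using g e by (simp add: p(1) e_def[symmetric]) (simp add: n)
    show "(case p of (d, m) \<Rightarrow> m * (n div d)) \<in> {1..n}"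
      using p(3,4) e by (simp add: p(1) e_def[symmetric]) (simp add: n)
    show "F (unity n (case p of (d, m) \<Rightarrow> m * (n div d))) = (case p of (d, m) \<Rightarrow> F (unity d m))"
      using unity_cancel[OF e, of d m] by (simp add: p(1) e_def[symmetric]) (simp add: n)
  next
    fix k assume k: "k \<in> {1..n}"
    define g where "g = gcd k n"
    have g: "g dvd k" "g dvd n" "g \<ge> 1" using k by (auto simp: g_def Suc_le_eq)
    have "coprime (k div g) (n div g)" unfolding g_def using k by (intro div_gcd_coprime) auto
    moreover have "1 \<le> k div g" using k g by (simp add: Suc_le_eq div_greater_zero_iff dvd_imp_le)
    moreover have "k div g \<le> n div g" using k by (simp add: div_le_mono)
    ultimately show "(n div gcd k n, k div gcd k n) \<in> (SIGMA d:{d. d dvd n}. residues_coprime d)"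
      using g(2) by (auto simp: g_def[symmetric] residues_coprime_def)
    have "n div (n div g) = g" using g assms by (metis div_div_eq_right div_self dvd_refl mult_1 not_one_le_zero)
    then show "(case (n div gcd k n, k div gcd k n) of (d, m) \<Rightarrow> m * (n div d)) = k"
      using g by (simp add: g_def[symmetric])
  qed
  finally show ?thesis .
qed

lemma sum_unity_powers:
  assumes "n \<ge> 1"
  shows "(\<Sum>k=1..n. unity n k ^ r) = (if n dvd r then of_nat n else 0)"
proof -
  have "(\<Sum>k=1..n. unity n k ^ r) = (\<Sum>k=1..n. unity n r ^ k)"
    by (simp add: unity_power mult.commute)
  also have "\<dots> = (if n dvd r then of_nat n else 0)"
  proof (cases "n dvd r")
    case True
    then show ?thesis using unity_eq_1_iff[OF assms, of r] by simp
  next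
    case False
    then have "unity n r \<noteq> 1" using unity_eq_1_iff[OF assms] by simp
    moreover have "unity n r ^ n = 1" using unity_eq_1_iff[OF assms] by (simp add: unity_power)
    ultimately have "(\<Sum>k<n. unity n r ^ k) = 0"
      using geometric_sum[of "unity n r" n] by simp
    moreover have "(\<Sum>k=1..n. unity n r ^ k) = unity n r * (\<Sum>k<n. unity n r ^ k)"
      by (simp add: sum.atLeast1_atMost_eq sum_distrib_left)
    ultimately show ?thesis using False by simp
  qed
  finally show ?thesis .
qed

lemma sum_ramanujan_sum:
  assumes "n \<ge> 1"
  shows "(\<Sum>d | d dvd n. ramanujan_sum d r) = (if n dvd r then of_nat n else 0)"
  unfolding ramanujan_sum_unity
  using sum_lowest_terms[OF assms, of "\<lambda>z. z ^ r"] sum_unity_powers[OF assms] by simp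

text \<open>
  By \<open>sum_ramanujan_sum\<close> the values \<open>c\<^sub>g(r)\<close> for \<open>g\<close> dividing \<open>d\<close> are determined recursively by which
  divisors of \<open>d\<close> divide \<open>r\<close>.
\<close>

lemma ramanujan_sum_gcd_cong:
  assumes "d \<ge> 1" "gcd d r = gcd d s"
  shows "ramanujan_sum d r = ramanujan_sum d s"
  using assms
proof (induction d rule: less_induct)
  case (less d)
  have fin: "finite {g. g dvd d}" using less.prems(1) by simp
  have split: "ramanujan_sum d t = (if d dvd t then of_nat d else 0) - (\<Sum>g\<in>{g. g dvd d} - {d}. ramanujan_sum g t)" for t
    using sum_ramanujan_sum[OF less.prems(1), of t] sum.remove[OF fin, of d "\<lambda>g. ramanujan_sum g t"]
    by (simp add: algebra_simps)
  have "ramanujan_sum g r = ramanujan_sum g s" if "g \<in> {g. g dvd d} - {d}" for g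
  proof (rule less.IH)
    have g: "g dvd d" "g \<noteq> d" using that by auto
    show "g < d" using g less.prems(1) dvd_imp_le[of g d] by simp
    show "1 \<le> g" using g less.prems(1) by (cases "g = 0") auto
    have "gcd g t = gcd g (gcd d t)" for t
      using g(1) by (metis gcd.assoc gcd_nat.absorb1)
    then show "gcd g r = gcd g s" using less.prems(2) by metis
  qed
  moreover have "d dvd r \<longleftrightarrow> d dvd s"
    using less.prems(2) by (metis gcd_nat.absorb_iff1)
  ultimately show ?case unfolding split[of r] split[of s] by simp
qed

text \<open>
  Put \<open>s = d / q^j\<close>, which is divisible by every prime divisor of \<open>d\<close>. Adding \<open>s\<close> permutes the residues
  prime to \<open>d\<close>, and it multiplies every summand by \<open>exp (2\<pi>i s r / d) = exp (2\<pi>i r / q^j) \<noteq> 1\<close>.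
\<close>

lemma ramanujan_sum_eq_0:
  assumes q: "prime q" and d: "d \<ge> 1" and qd: "q ^ Suc j dvd d" and qr: "\<not> q ^ j dvd r"
  shows "ramanujan_sum d r = 0"
proof -
  obtain c where c: "d = q ^ Suc j * c" using qd by blast
  define s where "s = q * c"
  have ds: "d = q ^ j * s" by (simp add: s_def c mult_ac)
  have s0: "s > 0" using ds d by (cases "s = 0") auto
  have j: "j > 0" using qr by (cases j) auto
  have d1: "d > 1"
    using dvd_imp_le[OF qd] d prime_gt_1_nat[OF q] one_less_power[of q "Suc j"] by simp
  have ps: "p dvd s" if p: "prime p" "p dvd d" for p
  proof -
    have "p dvd q ^ j \<or> p dvd s" using p(2) prime_dvd_mult_iff[OF p(1)] by (simp add: ds)
    then show ?thesis
    proof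
      assume "p dvd q ^ j"
      then have "p dvd q" by (rule prime_dvd_power[OF p(1)])
      then have "p = q" by (rule primes_dvd_imp_eq[OF p(1) q])
      then show ?thesis by (simp add: s_def)
    qed
  qed
  have cop: "coprime (m + s) d \<longleftrightarrow> coprime m d" for m
  proof -
    have cop_iff: "coprime x d \<longleftrightarrow> (\<forall>p. prime p \<and> p dvd d \<longrightarrow> \<not> p dvd x)" for x
    proof
      assume "coprime x d"
      then have "is_unit p" if "p dvd d" "p dvd x" for p
        using that(2,1) by (rule coprime_common_divisor)
      then show "\<forall>p. prime p \<and> p dvd d \<longrightarrow> \<not> p dvd x" using not_prime_unit by blast
    next
      assume *: "\<forall>p. prime p \<and> p dvd d \<longrightarrow> \<not> p dvd x"
      show "coprime x d"
      proof (rule ccontr)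
        assume "\<not> coprime x d"
        then have "gcd x d \<noteq> 1" by (simp add: coprime_iff_gcd_eq_1)
        then obtain p where "prime p" "p dvd gcd x d" using prime_factor_nat by blast
        then show False using * by (metis gcd_greatest_iff)
      qed
    qed
    have "p dvd m + s \<longleftrightarrow> p dvd m" if "prime p" "p dvd d" for p
      using dvd_add_left_iff[OF ps[OF that]] by simp
    then show ?thesis unfolding cop_iff by blast
  qed
  let ?M = "residues_coprime d"
  \<comment> \<open>as \<open>d > 1\<close>, the representative \<open>d\<close> of the residue \<open>0\<close> is not prime to \<open>d\<close>\<close>
  have M: "m \<in> ?M \<longleftrightarrow> m < d \<and> coprime m d" for m
    using d1 by (cases "m = 0"; cases "m = d") (auto simp: residues_coprime_def)
  define h where "h m = (m + s) mod d" for m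
  have "inj_on h ?M"
  proof (rule inj_onI)
    fix x y assume "x \<in> ?M" "y \<in> ?M" "h x = h y"
    then obtain q1 q2 where "x + s + d * q1 = y + s + d * q2"
      unfolding h_def nat_mod_eq_iff by blast
    then have "x + d * q1 = y + d * q2" by simp
    then have "x mod d = y mod d" unfolding nat_mod_eq_iff by blast
    then show "x = y" using \<open>x \<in> ?M\<close> \<open>y \<in> ?M\<close> M by simp
  qed
  moreover have hM: "h ` ?M \<subseteq> ?M"
    using M cop d1 by (auto simp: h_def) 
  ultimately have "h ` ?M = ?M" by (intro endo_inj_surj) auto
  then have "ramanujan_sum d r = (\<Sum>m\<in>h ` ?M. unity d m ^ r)" by (simp add: ramanujan_sum_unity)
  also have "\<dots> = (\<Sum>m\<in>?M. unity d (h m) ^ r)"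
    using \<open>inj_on h ?M\<close> by (simp add: sum.reindex)
  also have "\<dots> = (\<Sum>m\<in>?M. unity d s ^ r * unity d m ^ r)"
    using d by (simp add: h_def unity_mod unity_add power_mult_distrib mult.commute)
  also have "\<dots> = unity d s ^ r * ramanujan_sum d r"
    by (simp add: ramanujan_sum_unity sum_distrib_left)
  finally have "(1 - unity d s ^ r) * ramanujan_sum d r = 0" by (simp add: algebra_simps)
  moreover have "unity d s ^ r \<noteq> 1"
  proof
    assume "unity d s ^ r = 1"
    then have "d dvd s * r" using unity_eq_1_iff[OF d] by (simp add: unity_power)
    then have "s * q ^ j dvd s * r" by (simp add: ds mult.commute)
    then show False using s0 qr by simp
  qed
  ultimately show ?thesis by simp
qed

text \<open>
  For each root of unity \<open>z\<close> in the Ramanujan sum, the sum over \<open>t\<close> is geometric with ratio \<open>z^(r l)\<close>,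
  whose \<open>E\<close>-th power is \<open>1\<close>.
\<close>

lemma average_ramanujan_sum:
  assumes d: "d \<ge> 1" and dvd: "d dvd E * (r * l)"
  shows "(\<Sum>t<E. ramanujan_sum d (r * (1 + l * t))) = (if d dvd r * l then of_nat E * ramanujan_sum d r else 0)"
proof -
  have "(\<Sum>t<E. ramanujan_sum d (r * (1 + l * t)))
      = (\<Sum>m\<in>residues_coprime d. \<Sum>t<E. unity d m ^ (r * (1 + l * t)))"
    unfolding ramanujan_sum_unity by (rule sum.swap)
  also have "\<dots> = (\<Sum>m\<in>residues_coprime d. unity d m ^ r * (if d dvd r * l then of_nat E else 0))"
  proof (rule sum.cong[OF refl])
    fix m assume "m \<in> residues_coprime d"
    then have z: "unity d m ^ k = 1 \<longleftrightarrow> d dvd k" for k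
      using primitive_unity[OF d, of m] by (simp add: residues_coprime_def primitive_root_of_unity_def)
    define x where "x = unity d m ^ (r * l)"
    have "unity d m ^ (r * (1 + l * t)) = unity d m ^ r * x ^ t" for t
      by (simp add: x_def power_add power_mult distrib_left mult.assoc[symmetric])
    then have "(\<Sum>t<E. unity d m ^ (r * (1 + l * t))) = unity d m ^ r * (\<Sum>t<E. x ^ t)"
      by (simp add: sum_distrib_left)
    also have "(\<Sum>t<E. x ^ t) = (if d dvd r * l then of_nat E else 0)"
    proof (cases "d dvd r * l")
      case True
      then have "x = 1" using z by (simp add: x_def)
      then show ?thesis using True by simp
    next
      case False
      then have "x \<noteq> 1" using z by (simp add: x_def)
      moreover have "x ^ E = 1" using z dvd by (simp add: x_def power_mult[symmetric] mult.commute)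
      ultimately show ?thesis using False geometric_sum[of x E] by simp
    qed
    finally show "(\<Sum>t<E. unity d m ^ (r * (1 + l * t))) = unity d m ^ r * (if d dvd r * l then of_nat E else 0)" .
  qed
  also have "\<dots> = (if d dvd r * l then of_nat E * ramanujan_sum d r else 0)"
    by (simp add: ramanujan_sum_unity sum_distrib_left mult.commute)
  finally show ?thesis .
qed

text \<open>
  Write \<open>N = N\<^sub>0 E\<close> and let \<open>i\<close>, \<open>u\<close>, \<open>v \<le> 1\<close> be the multiplicities of a prime \<open>q\<close> in \<open>d\<close>, \<open>N\<close>, \<open>A\<close>. Then
  \<open>q\<close> has multiplicity \<open>2u + v - i\<close> in \<open>n/d\<close>. If \<open>i \<le> u + v\<close> for all \<open>q\<close>, then
  \<open>min i (2u + v - i) = min i u\<close>, so \<open>n/d\<close> and \<open>N\<close> have the same greatest common divisor with \<open>d\<close>. If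
  \<open>i > u + v\<close> for some \<open>q\<close>, then \<open>2u + v - i < i - 1\<close> and \<open>c\<^sub>d(n/d) = 0\<close>; when in addition \<open>d\<close> divides
  \<open>N A N\<^sub>0\<^sup>2\<close>, such a \<open>q\<close> must divide \<open>A\<close>, so that \<open>u < i - 1\<close> and \<open>c\<^sub>d(N) = 0\<close> as well.
\<close>

lemma ramanujan_sum_complementary:
  fixes A N\<^sub>0 E d :: nat
  assumes pos: "A > 0" "N\<^sub>0 > 0" "E > 0"
    and sqf: "\<And>q. prime q \<Longrightarrow> multiplicity q A \<le> 1"
    and N0: "\<And>q. prime q \<Longrightarrow> \<not> q dvd A \<Longrightarrow> \<not> q dvd N\<^sub>0"
    and E: "\<And>q. prime q \<Longrightarrow> q dvd A \<Longrightarrow> \<not> q dvd E"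
    and dn: "d dvd A * N\<^sub>0\<^sup>2 * E\<^sup>2"
  shows "ramanujan_sum d (A * N\<^sub>0\<^sup>2 * E\<^sup>2 div d)
    = (if d dvd (N\<^sub>0 * E) * (A * N\<^sub>0\<^sup>2) then ramanujan_sum d (N\<^sub>0 * E) else 0)"
proof -
  define n where "n = A * N\<^sub>0\<^sup>2 * E\<^sup>2"
  define N where "N = N\<^sub>0 * E"
  have n0: "n > 0" using pos by (simp add: n_def)
  have N_pos: "N > 0" using pos by (simp add: N_def)
  have d: "d > 0" using n0 dn unfolding n_def by (cases "d = 0") auto
  have nd0: "n div d > 0" using dn n0 d by (simp add: n_def div_greater_zero_iff dvd_imp_le)
  have nN: "n = A * (N * N)" by (simp add: n_def N_def power2_eq_square mult_ac)
  have vn: "multiplicity q n = multiplicity q A + 2 * multiplicity q N" if "prime q" for q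
    unfolding nN using that pos N_pos by (simp add: prime_elem_multiplicity_mult_distrib)
  have vnd: "multiplicity q (n div d) + multiplicity q d = multiplicity q A + 2 * multiplicity q N" if "prime q" for q
  proof -
    have "multiplicity q (n div d * d) = multiplicity q (n div d) + multiplicity q d"
      using that d nd0 by (intro prime_elem_multiplicity_mult_distrib) auto
    then show ?thesis using dn vn[OF that] by (simp add: n_def)
  qed
  have vNA: "multiplicity q (N * A) = multiplicity q N + multiplicity q A" if "prime q" for q
    using that pos N_pos by (intro prime_elem_multiplicity_mult_distrib) auto
  have pow: "q ^ i dvd x \<longleftrightarrow> i \<le> multiplicity q x" if "prime q" "x > 0" for q i x :: nat
    using that by (intro power_dvd_iff_le_multiplicity) (auto simp: prime_nat_iff)
  have "ramanujan_sum d (n div d) = (if d dvd N * (A * N\<^sub>0\<^sup>2) then ramanujan_sum d N else 0)"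
  proof (cases "d dvd N * A")
    case True
    then have dd: "d dvd N * (A * N\<^sub>0\<^sup>2)" by (metis dvd_mult2 mult.assoc)
    have "gcd d (n div d) = gcd d N"
    proof (rule multiplicity_eq_nat)
      fix q :: nat assume q: "prime q"
      have "multiplicity q d \<le> multiplicity q N + multiplicity q A"
        unfolding vNA[OF q, symmetric] using True N_pos pos by (intro dvd_imp_multiplicity_le) auto
      then show "multiplicity q (gcd d (n div d)) = multiplicity q (gcd d N)"
        using vnd[OF q] sqf[OF q] d nd0 N_pos by (simp add: multiplicity_gcd[OF _ _ q])
    qed (use d in auto)
    then have "ramanujan_sum d (n div d) = ramanujan_sum d N"
      using d by (intro ramanujan_sum_gcd_cong) auto
    then show ?thesis using dd by simp
  next
    case False
    then obtain q where q: "prime q" and gt: "multiplicity q (N * A) < multiplicity q d"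
      using multiplicity_le_imp_dvd[of d "N * A"] d by (metis linorder_not_le less_irrefl)
    obtain j where j: "multiplicity q d = Suc j" using gt by (cases "multiplicity q d") auto
    have qd: "q ^ Suc j dvd d" unfolding pow[OF q d] j by (rule order_refl)
    have zero: "ramanujan_sum d r = 0" if "multiplicity q r < j" "r > 0" for r
      using d that pow[OF q that(2), of j] by (intro ramanujan_sum_eq_0[OF q _ qd]) auto
    have "ramanujan_sum d (n div d) = 0"
      by (rule zero) (use vnd[OF q] gt vNA[OF q] j nd0 in auto)
    moreover have "ramanujan_sum d N = 0" if dd: "d dvd N * (A * N\<^sub>0\<^sup>2)"
    proof (rule zero[OF _ N_pos])
      have "q dvd A"
      proof (rule ccontr)
        assume nA: "\<not> q dvd A"
        then have "multiplicity q A = 0" "multiplicity q N\<^sub>0 = 0"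
          using N0[OF q] by (auto simp: not_dvd_imp_multiplicity_0)
        then have "multiplicity q (N * (A * N\<^sub>0\<^sup>2)) = multiplicity q N"
          using q pos N_pos by (simp add: prime_elem_multiplicity_mult_distrib prime_elem_multiplicity_power_distrib)
        moreover have "multiplicity q d \<le> multiplicity q (N * (A * N\<^sub>0\<^sup>2))"
          using dd pos N_pos by (intro dvd_imp_multiplicity_le) auto
        ultimately show False using gt vNA[OF q] by simp
      qed
      then have "multiplicity q A \<ge> 1" using pow[OF q pos(1), of 1] by simp
      then show "multiplicity q N < j" using gt vNA[OF q] j by simp
    qed
    ultimately show ?thesis by simp
  qed
  then show ?thesis by (simp add: n_def N_def)
qed

text \<open>
  The averaged arguments do not depend on \<open>d\<close>. For a prime \<open>q\<close> dividing \<open>A\<close> they are all equal to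
  \<open>N\<^sub>0 E\<close> modulo the power of \<open>q\<close> in \<open>n\<close>, and for a prime dividing \<open>E\<close> they run through the multiples
  of the power of \<open>q\<close> in \<open>E\<close>.
\<close>

lemma ramanujan_sum_as_average:
  fixes A N\<^sub>0 E d :: nat
  assumes pos: "A > 0" "N\<^sub>0 > 0" "E > 0"
    and sqf: "\<And>q. prime q \<Longrightarrow> multiplicity q A \<le> 1"
    and N0: "\<And>q. prime q \<Longrightarrow> \<not> q dvd A \<Longrightarrow> \<not> q dvd N\<^sub>0"
    and E: "\<And>q. prime q \<Longrightarrow> q dvd A \<Longrightarrow> \<not> q dvd E"
    and dn: "d dvd A * N\<^sub>0\<^sup>2 * E\<^sup>2"
  shows "of_nat E * ramanujan_sum d (A * N\<^sub>0\<^sup>2 * E\<^sup>2 div d)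
    = (\<Sum>t<E. ramanujan_sum d (N\<^sub>0 * E * (1 + A * N\<^sub>0\<^sup>2 * t)))"
proof -
  have d: "d \<ge> 1" using dn pos by (cases "d = 0") auto
  have "A * N\<^sub>0\<^sup>2 * E\<^sup>2 dvd E * (N\<^sub>0 * E * (A * N\<^sub>0\<^sup>2))"
    by (rule dvdI[of _ _ N\<^sub>0]) (simp add: power2_eq_square mult_ac)
  then have "d dvd E * (N\<^sub>0 * E * (A * N\<^sub>0\<^sup>2))" using dn dvd_trans by blast
  from average_ramanujan_sum[OF d this] ramanujan_sum_complementary[OF assms]
  show ?thesis by simp
qed

section \<open>Schur positivity\<close>

lemma mps_symmetric_power_sum: "mps_symmetric (power_sum d)"
  unfolding mps_symmetric_def
proof (intro allI impI)
  fix \<pi> :: "nat \<Rightarrow> nat" and m :: "nat multiset" assume \<pi>: "bij \<pi>"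
  have "(\<exists>i. image_mset \<pi> m = replicate_mset d i) \<longleftrightarrow> (\<exists>i. m = replicate_mset d i)"
  proof
    assume "\<exists>i. image_mset \<pi> m = replicate_mset d i"
    then obtain i where i: "image_mset \<pi> m = replicate_mset d i" by blast
    have "m = image_mset (inv \<pi>) (image_mset \<pi> m)"
      using \<pi> by (simp add: image_mset.compositionality bij_is_inj o_def)
    then have "m = replicate_mset d (inv \<pi> i)" unfolding i by simp
    then show "\<exists>i. m = replicate_mset d i" by blast
  qed auto
  then show "mps_coeff (power_sum d) (image_mset \<pi> m) = mps_coeff (power_sum d) m"
    by (simp add: power_sum.rep_eq)
qed

lemma mps_symmetric_mult:
  assumes "mps_symmetric f" "mps_symmetric g"
  shows "mps_symmetric (f * g)"
  unfolding mps_symmetric_def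
proof (intro allI impI)
  fix \<pi> :: "nat \<Rightarrow> nat" and m :: "nat multiset" assume \<pi>: "bij \<pi>"
  have inv: "image_mset (inv \<pi>) (image_mset \<pi> x) = x" "image_mset \<pi> (image_mset (inv \<pi>) x) = x" for x
    using \<pi> by (simp_all add: image_mset.compositionality bij_is_inj bij_is_surj surj_f_inv_f o_def)
  have \<pi>f: "mps_coeff f (image_mset \<pi> x) = mps_coeff f x" "mps_coeff g (image_mset \<pi> x) = mps_coeff g x" for x
    using assms \<pi> by (simp_all add: mps_symmetric_def)
  show "mps_coeff (f * g) (image_mset \<pi> m) = mps_coeff (f * g) m"
    unfolding times_mps.rep_eq
  proof (rule sum.reindex_bij_witness[where i = "\<lambda>(a, b). (image_mset \<pi> a, image_mset \<pi> b)"
        and j = "\<lambda>(a, b). (image_mset (inv \<pi>) a, image_mset (inv \<pi>) b)"])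
    fix p assume "p \<in> {(a, b). a + b = image_mset \<pi> m}"
    then obtain a b where p: "p = (a, b)" "a + b = image_mset \<pi> m" by blast
    show "(case case p of (a, b) \<Rightarrow> (image_mset (inv \<pi>) a, image_mset (inv \<pi>) b) of
        (a, b) \<Rightarrow> (image_mset \<pi> a, image_mset \<pi> b)) = p"
      by (simp add: p(1) inv)
    show "(case p of (a, b) \<Rightarrow> (image_mset (inv \<pi>) a, image_mset (inv \<pi>) b)) \<in> {(a, b). a + b = m}"
      using arg_cong[OF p(2), of "image_mset (inv \<pi>)"] by (simp add: p(1) inv)
    show "(case case p of (a, b) \<Rightarrow> (image_mset (inv \<pi>) a, image_mset (inv \<pi>) b) of
        (a, b) \<Rightarrow> mps_coeff f a * mps_coeff g b) = (case p of (a, b) \<Rightarrow> mps_coeff f a * mps_coeff g b)"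
      using \<pi>f(1)[of "image_mset (inv \<pi>) a"] \<pi>f(2)[of "image_mset (inv \<pi>) b"]
      by (simp add: p(1) inv)
  next
    fix p assume "p \<in> {(a, b). a + b = m}"
    then obtain a b where p: "p = (a, b)" "a + b = m" by blast
    show "(case case p of (a, b) \<Rightarrow> (image_mset \<pi> a, image_mset \<pi> b) of
        (a, b) \<Rightarrow> (image_mset (inv \<pi>) a, image_mset (inv \<pi>) b)) = p"
      by (simp add: p(1) inv)
    show "(case p of (a, b) \<Rightarrow> (image_mset \<pi> a, image_mset \<pi> b)) \<in> {(a, b). a + b = image_mset \<pi> m}"
      using p by auto
  qed
qed

lemma mps_symmetric_power: "mps_symmetric f \<Longrightarrow> mps_symmetric (f ^ k)"
proof (induction k)
  case 0
  show ?case by (simp add: mps_symmetric_def one_mps.rep_eq)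
qed (simp add: mps_symmetric_mult)

lemma mps_symmetric_ramanujan: "mps_symmetric (mps_smult c (ramanujan_symfun n))"
  unfolding mps_symmetric_def
proof (intro allI impI)
  fix \<pi> :: "nat \<Rightarrow> nat" and m :: "nat multiset" assume \<pi>: "bij \<pi>"
  have "mps_coeff (power_sum d ^ k) (image_mset \<pi> m) = mps_coeff (power_sum d ^ k :: complex mps) m" for d k
    using mps_symmetric_power[OF mps_symmetric_power_sum] \<pi> unfolding mps_symmetric_def by blast
  then show "mps_coeff (mps_smult c (ramanujan_symfun n)) (image_mset \<pi> m)
      = mps_coeff (mps_smult c (ramanujan_symfun n)) m"
    by (simp add: ramanujan_symfun_def mps_coeff_sum mps_smult.rep_eq)
qed

lemma mps_homogeneous_ramanujan:
  assumes "n \<ge> 1"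
  shows "mps_homogeneous n (mps_smult c (ramanujan_symfun n))"
  unfolding mps_homogeneous_def
proof (intro allI impI)
  fix m assume "mps_coeff (mps_smult c (ramanujan_symfun n)) m \<noteq> 0"
  then have "(\<Sum>d | d dvd n. ramanujan_sum d (n div d) * mps_coeff (power_sum d ^ (n div d)) m) \<noteq> 0"
    by (simp add: ramanujan_symfun_def mps_coeff_sum mps_smult.rep_eq)
  then obtain d where d: "d dvd n" "mps_coeff (power_sum d ^ (n div d)) m \<noteq> (0 :: complex)"
    by (metis (mono_tags, lifting) mem_Collect_eq mult_eq_0_iff sum.neutral)
  have d1: "d \<ge> 1" using d(1) assms by (cases "d = 0") auto
  obtain N where N: "set_mset m \<subseteq> {..<N}"
    by (meson finite_nat_iff_bounded finite_set_mset)
  have "mps_coeff (power_sum d ^ (n div d)) m * (\<Prod>i<N. fact (count m i div d)) \<noteq> (0 :: complex)"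
    using d(2) by simp
  then have "size m = d * (n div d)"
    unfolding coeff_power_sum_power[OF d1 N] by (metis (full_types))
  then show "size m = n" using d(1) by simp
qed

text \<open>
Averaging over the \<open>n\<close>-th roots of unity keeps the exponents in one residue class.
\<close>

lemma root_of_unity_filter:
  assumes "n \<ge> 1"
  shows "(\<Sum>k=1..n. unity n k ^ r * poly p (unity n k))
    = of_nat n * (\<Sum>e\<le>degree p. if n dvd r + e then coeff p e else 0)"
proof -
  have "(\<Sum>k=1..n. unity n k ^ r * poly p (unity n k))
      = (\<Sum>k=1..n. \<Sum>e\<le>degree p. coeff p e * unity n k ^ (r + e))"
    by (simp add: poly_altdef sum_distrib_left power_add mult_ac)
  also have "\<dots> = (\<Sum>e\<le>degree p. coeff p e * (\<Sum>k=1..n. unity n k ^ (r + e)))"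
    unfolding sum_distrib_left by (rule sum.swap)
  also have "\<dots> = (\<Sum>e\<le>degree p. of_nat n * (if n dvd r + e then coeff p e else 0))"
    by (rule sum.cong[OF refl]) (simp only: sum_unity_powers[OF assms], simp)
  finally show ?thesis by (simp add: sum_distrib_left)
qed

text \<open>
  The coefficient of \<open>s\<^sub>\<lambda>\<close> is the number of standard tableaux of shape \<open>\<lambda>\<close> with \<open>r + maj\<close> divisible by
  \<open>n\<close>, read off from the coefficients of the major index polynomial.
\<close>

lemma foulkes_schur_expansion:
  assumes n: "n \<ge> 1"
  shows "\<exists>k :: nat list \<Rightarrow> nat. (\<Sum>d | d dvd n. mps_smult (ramanujan_sum d r) (power_sum d ^ (n div d)))
    = mps_smult (of_nat n) (\<Sum>ps\<in>partitions_of n. mps_smult (of_nat (k ps)) (schur ps))"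
proof -
  define c where "c ps = (\<Sum>e\<le>degree (maj_gf n ps). if n dvd r + e then coeff (maj_gf n ps) e else 0)" for ps
  have "c ps \<in> \<nat>" for ps
    unfolding c_def maj_gf_def by (rule sum_in_Nats) (simp add: maj_poly_coeff_Nats)
  then have "\<forall>ps. \<exists>j. c ps = of_nat j" by (auto elim: Nats_cases)
  then obtain k where k: "\<And>ps. c ps = of_nat (k ps)" by metis
  have "(\<Sum>d | d dvd n. mps_smult (ramanujan_sum d r) (power_sum d ^ (n div d)))
    = mps_smult (of_nat n) (\<Sum>ps\<in>partitions_of n. mps_smult (of_nat (k ps)) (schur ps))"
  proof (rule mps_eqI)
    fix m
    let ?s = "\<lambda>ps. mps_coeff (schur ps) m :: complex"
    have "mps_coeff (\<Sum>d | d dvd n. mps_smult (ramanujan_sum d r) (power_sum d ^ (n div d))) m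
        = (\<Sum>d | d dvd n. \<Sum>z\<in>residues_coprime d. unity d z ^ r * mps_coeff (power_sum d ^ (n div d)) m)"
      by (simp add: mps_coeff_sum mps_smult.rep_eq ramanujan_sum_unity sum_distrib_right)
    also have "\<dots> = (\<Sum>d | d dvd n. \<Sum>z\<in>residues_coprime d.
        unity d z ^ r * (\<Sum>ps\<in>partitions_of n. poly (maj_gf n ps) (unity d z) * ?s ps))"
    proof (intro sum.cong refl)
      fix d z assume d: "d \<in> {d. d dvd n}" and z: "z \<in> residues_coprime d"
      have "d \<ge> 1" using d n by (cases "d = 0") auto
      then have "primitive_root_of_unity d (unity d z)"
        using z by (intro primitive_unity) (auto simp: residues_coprime_def)
      from power_sum_eq_sum_schur[OF this, of n] d
      have "mps_coeff (power_sum d ^ (n div d)) m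
          = (\<Sum>ps\<in>partitions_of n. poly (maj_gf n ps) (unity d z) * ?s ps)"
        by (simp add: mps_coeff_sum mps_smult.rep_eq)
      then show "unity d z ^ r * mps_coeff (power_sum d ^ (n div d)) m
        = unity d z ^ r * (\<Sum>ps\<in>partitions_of n. poly (maj_gf n ps) (unity d z) * ?s ps)"
        by simp
    qed
    also have "\<dots> = (\<Sum>j=1..n. unity n j ^ r * (\<Sum>ps\<in>partitions_of n. poly (maj_gf n ps) (unity n j) * ?s ps))"
      by (rule sum_lowest_terms[OF n, of "\<lambda>u. u ^ r * (\<Sum>ps\<in>partitions_of n. poly (maj_gf n ps) u * ?s ps)"])
    also have "\<dots> = (\<Sum>ps\<in>partitions_of n. \<Sum>j=1..n. unity n j ^ r * poly (maj_gf n ps) (unity n j) * ?s ps)"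
      unfolding sum_distrib_left by (subst sum.swap) (simp add: mult.assoc)
    also have "\<dots> = (\<Sum>ps\<in>partitions_of n. of_nat n * c ps * ?s ps)"
      unfolding sum_distrib_right[symmetric] root_of_unity_filter[OF n] c_def ..
    also have "\<dots> = mps_coeff (mps_smult (of_nat n)
        (\<Sum>ps\<in>partitions_of n. mps_smult (of_nat (k ps)) (schur ps))) m"
      by (simp add: mps_coeff_sum mps_smult.rep_eq sum_distrib_left k mult.assoc)
    finally show "mps_coeff (\<Sum>d | d dvd n. mps_smult (ramanujan_sum d r) (power_sum d ^ (n div d))) m
        = mps_coeff (mps_smult (of_nat n)
        (\<Sum>ps\<in>partitions_of n. mps_smult (of_nat (k ps)) (schur ps))) m" .
  qed
  then show ?thesis by blast
qed

text \<open>
  By \<open>ramanujan_sum_as_average\<close>, \<open>E\<close> times the left hand side is a sum of \<open>E\<close> functions as in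
  \<open>foulkes_schur_expansion\<close>, each \<open>n = (A N\<^sub>0\<^sup>2 E) E\<close> times a Schur positive one.
\<close>

lemma ramanujan_symfun_schur_expansion:
  fixes A N\<^sub>0 E :: nat
  assumes pos: "A > 0" "N\<^sub>0 > 0" "E > 0"
    and sqf: "\<And>q. prime q \<Longrightarrow> multiplicity q A \<le> 1"
    and N0: "\<And>q. prime q \<Longrightarrow> \<not> q dvd A \<Longrightarrow> \<not> q dvd N\<^sub>0"
    and E: "\<And>q. prime q \<Longrightarrow> q dvd A \<Longrightarrow> \<not> q dvd E"
    and n: "n = A * N\<^sub>0\<^sup>2 * E\<^sup>2"
  shows "\<exists>k :: nat list \<Rightarrow> nat. ramanujan_symfun n
    = mps_smult (of_nat (A * N\<^sub>0\<^sup>2 * E)) (\<Sum>ps\<in>partitions_of n. mps_smult (of_nat (k ps)) (schur ps))"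
proof -
  have n1: "n \<ge> 1" using pos by (simp add: n Suc_le_eq)
  define r where "r t = N\<^sub>0 * E * (1 + A * N\<^sub>0\<^sup>2 * t)" for t
  obtain K :: "nat \<Rightarrow> nat list \<Rightarrow> nat" where
    K: "\<And>r. (\<Sum>d | d dvd n. mps_smult (ramanujan_sum d r) (power_sum d ^ (n div d)))
      = mps_smult (of_nat n) (\<Sum>ps\<in>partitions_of n. mps_smult (of_nat (K r ps)) (schur ps))"
    using foulkes_schur_expansion[OF n1] by metis
  define k where "k ps = (\<Sum>t<E. K (r t) ps)" for ps
  have "ramanujan_symfun n
    = mps_smult (of_nat (A * N\<^sub>0\<^sup>2 * E)) (\<Sum>ps\<in>partitions_of n. mps_smult (of_nat (k ps)) (schur ps))"
  proof (rule mps_eqI)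
    fix m
    let ?p = "\<lambda>d. mps_coeff (power_sum d ^ (n div d)) m :: complex"
    let ?s = "\<lambda>ps. mps_coeff (schur ps) m :: complex"
    have "of_nat E * mps_coeff (ramanujan_symfun n) m
        = (\<Sum>d | d dvd n. (of_nat E * ramanujan_sum d (n div d)) * ?p d)"
      by (simp add: ramanujan_symfun_def mps_coeff_sum mps_smult.rep_eq sum_distrib_left mult.assoc)
    also have "\<dots> = (\<Sum>d | d dvd n. (\<Sum>t<E. ramanujan_sum d (r t)) * ?p d)"
    proof (rule sum.cong[OF refl])
      fix d assume "d \<in> {d. d dvd n}"
      then have dvd: "d dvd A * N\<^sub>0\<^sup>2 * E\<^sup>2" by (simp add: n)
      have "of_nat E * ramanujan_sum d (A * N\<^sub>0\<^sup>2 * E\<^sup>2 div d)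
          = (\<Sum>t<E. ramanujan_sum d (N\<^sub>0 * E * (1 + A * N\<^sub>0\<^sup>2 * t)))"
        using pos sqf N0 E dvd by (rule ramanujan_sum_as_average)
      then show "of_nat E * ramanujan_sum d (n div d) * ?p d = (\<Sum>t<E. ramanujan_sum d (r t)) * ?p d"
        by (simp only: n r_def)
    qed
    also have "\<dots> = (\<Sum>t<E. \<Sum>d | d dvd n. ramanujan_sum d (r t) * ?p d)"
      unfolding sum_distrib_right by (rule sum.swap)
    also have "\<dots> = (\<Sum>t<E. of_nat n * (\<Sum>ps\<in>partitions_of n. of_nat (K (r t) ps) * ?s ps))"
    proof (rule sum.cong[OF refl])
      fix t
      show "(\<Sum>d | d dvd n. ramanujan_sum d (r t) * ?p d)
          = of_nat n * (\<Sum>ps\<in>partitions_of n. of_nat (K (r t) ps) * ?s ps)"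
        using arg_cong[OF K[of "r t"], of "\<lambda>f. mps_coeff f m"] by (simp add: mps_coeff_sum mps_smult.rep_eq)
    qed
    also have "\<dots> = of_nat n * (\<Sum>ps\<in>partitions_of n. of_nat (k ps) * ?s ps)"
      unfolding sum_distrib_left[symmetric] k_def of_nat_sum sum_distrib_right
      by (subst sum.swap) (rule refl)
    also have "of_nat n = of_nat E * (of_nat (A * N\<^sub>0\<^sup>2 * E) :: complex)"
      by (simp add: n power2_eq_square)
    finally show "mps_coeff (ramanujan_symfun n) m = mps_coeff (mps_smult (of_nat (A * N\<^sub>0\<^sup>2 * E))
        (\<Sum>ps\<in>partitions_of n. mps_smult (of_nat (k ps)) (schur ps))) m"
      using pos by (simp add: mps_coeff_sum mps_smult.rep_eq mult.assoc)
  qed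
  then show ?thesis by blast
qed

lemma prime_dvd_prod_primes:
  assumes "finite S" "\<forall>p\<in>S. prime p" "prime q" "q dvd (\<Prod>p\<in>S. p ^ f p)"
  shows "(q :: nat) \<in> S"
proof -
  obtain p where "p \<in> S" "q dvd p ^ f p"
    using assms by (auto simp: prime_dvd_prod_iff)
  then have "q = p"
    using assms(2,3) prime_dvd_power primes_dvd_imp_eq by blast
  then show ?thesis using \<open>p \<in> S\<close> by simp
qed

text \<open>
  The scalar \<open>c\<close> may be any that turns \<open>n\<^sub>o \<surd>n\<^sub>e\<close> into a natural number; \<open>c = 1\<close> and
  \<open>c = 1 / (n\<^sub>o \<surd>n\<^sub>e)\<close> are the two cases of interest.
\<close>

lemma schur_positive_scaled:
  fixes a b :: "nat \<Rightarrow> nat"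
  assumes T: "finite T\<^sub>o" "finite T\<^sub>e" "T\<^sub>o \<inter> T\<^sub>e = {}" "\<forall>q\<in>T\<^sub>o. prime q" "\<forall>q\<in>T\<^sub>e. prime q"
    and n: "n = (\<Prod>q\<in>T\<^sub>o. q ^ (2 * a q + 1)) * (\<Prod>q\<in>T\<^sub>e. q ^ (2 * b q))"
    and c: "c * of_nat ((\<Prod>q\<in>T\<^sub>o. q ^ (2 * a q + 1)) * (\<Prod>q\<in>T\<^sub>e. q ^ b q)) = of_nat j"
  shows "schur_positive n (mps_smult c (ramanujan_symfun n))"
proof -
  define A where "A = (\<Prod>q\<in>T\<^sub>o. q ^ 1)"
  define N\<^sub>0 where "N\<^sub>0 = (\<Prod>q\<in>T\<^sub>o. q ^ a q)"
  define E where "E = (\<Prod>q\<in>T\<^sub>e. q ^ b q)"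
  have pos: "A > 0" "N\<^sub>0 > 0" "E > 0"
    using T prime_gt_0_nat unfolding A_def N\<^sub>0_def E_def by (auto intro!: prod_pos)
  have no: "(\<Prod>q\<in>T\<^sub>o. q ^ (2 * a q + 1)) = A * N\<^sub>0\<^sup>2"
    unfolding A_def N\<^sub>0_def prod_power_distrib prod.distrib[symmetric]
    by (intro prod.cong) (simp_all add: mult.commute flip: power_mult)
  have ne: "(\<Prod>q\<in>T\<^sub>e. q ^ (2 * b q)) = E\<^sup>2"
    unfolding E_def by (simp add: prod_power_distrib mult.commute flip: power_mult)
  have sqf: "multiplicity q A \<le> 1" if "prime q" for q
    unfolding A_def using T that by (subst multiplicity_prod_prime_powers) auto
  have dvdA: "q dvd A" if "q \<in> T\<^sub>o" for q
    unfolding A_def using T(1) that by (metis dvd_prodI power_one_right)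
  have N0: "\<not> q dvd N\<^sub>0" if "prime q" "\<not> q dvd A" for q
  proof
    assume "q dvd N\<^sub>0"
    then have "q \<in> T\<^sub>o" unfolding N\<^sub>0_def by (rule prime_dvd_prod_primes[OF T(1,4) that(1)])
    then show False using dvdA that(2) by blast
  qed
  have E: "\<not> q dvd E" if "prime q" "q dvd A" for q
  proof
    assume "q dvd E"
    then have "q \<in> T\<^sub>e" unfolding E_def by (rule prime_dvd_prod_primes[OF T(2,5) that(1)])
    moreover have "q \<in> T\<^sub>o" using that(2) unfolding A_def by (rule prime_dvd_prod_primes[OF T(1,4) that(1)])
    ultimately show False using T(3) by blast
  qed
  have n': "n = A * N\<^sub>0\<^sup>2 * E\<^sup>2" unfolding n no ne ..
  have n1: "n \<ge> 1" using pos by (simp add: n' Suc_le_eq)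
  obtain k :: "nat list \<Rightarrow> nat" where k: "ramanujan_symfun n
      = mps_smult (of_nat (A * N\<^sub>0\<^sup>2 * E)) (\<Sum>ps\<in>partitions_of n. mps_smult (of_nat (k ps)) (schur ps))"
  proof -
    have "\<exists>k :: nat list \<Rightarrow> nat. ramanujan_symfun n
      = mps_smult (of_nat (A * N\<^sub>0\<^sup>2 * E)) (\<Sum>ps\<in>partitions_of n. mps_smult (of_nat (k ps)) (schur ps))"
      using pos sqf N0 E n' by (rule ramanujan_symfun_schur_expansion)
    then show thesis using that by blast
  qed
  have c': "c * (of_nat (A * N\<^sub>0\<^sup>2 * E) * x) = of_nat j * x" for x
    using c unfolding no E_def[symmetric] by (metis mult.assoc)
  have "mps_smult c (ramanujan_symfun n) = (\<Sum>ps\<in>partitions_of n. mps_smult (of_nat (j * k ps)) (schur ps))"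
    unfolding k
    by (rule mps_eqI, simp only: mps_smult.rep_eq c')
      (simp add: mps_coeff_sum mps_smult.rep_eq sum_distrib_left mult.assoc)
  then have "\<exists>k :: nat list \<Rightarrow> nat. mps_smult c (ramanujan_symfun n)
      = (\<Sum>ps\<in>partitions_of n. mps_smult (of_nat (k ps)) (schur ps))"
    by (rule exI[of _ "\<lambda>ps. j * k ps"])
  then show ?thesis
    unfolding schur_positive_def
    using mps_symmetric_ramanujan mps_homogeneous_ramanujan[OF n1] by blast
qed

lemma odd_even_factorisation:
  fixes n :: nat
  assumes "n \<ge> 1"
  defines "T\<^sub>o \<equiv> {q \<in> prime_factors n. odd (multiplicity q n)}"
    and "T\<^sub>e \<equiv> {q \<in> prime_factors n. even (multiplicity q n)}"
  shows "n = (\<Prod>q\<in>T\<^sub>o. q ^ (2 * (multiplicity q n div 2) + 1)) * (\<Prod>q\<in>T\<^sub>e. q ^ (2 * (multiplicity q n div 2)))"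
proof -
  have "n = (\<Prod>q\<in>prime_factors n. q ^ multiplicity q n)"
    by (rule prime_factorization_nat) (use assms(1) in simp)
  also have "prime_factors n = T\<^sub>o \<union> T\<^sub>e" by (auto simp: T\<^sub>o_def T\<^sub>e_def)
  also have "(\<Prod>q\<in>T\<^sub>o \<union> T\<^sub>e. q ^ multiplicity q n) = (\<Prod>q\<in>T\<^sub>o. q ^ multiplicity q n) * (\<Prod>q\<in>T\<^sub>e. q ^ multiplicity q n)"
    by (rule prod.union_disjoint) (auto simp: T\<^sub>o_def T\<^sub>e_def)
  finally show ?thesis
    by (simp add: T\<^sub>o_def T\<^sub>e_def cong: prod.cong_simp)
qed

theorem theorem24:
  fixes n :: nat
  assumes "n \<ge> 1"
  shows "schur_positive n (ramanujan_symfun n) \<and>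
    (\<forall>(T\<^sub>o :: nat set) (T\<^sub>e :: nat set) (a :: nat \<Rightarrow> nat) (b :: nat \<Rightarrow> nat) (n\<^sub>o :: nat) (n\<^sub>e :: nat).
       finite T\<^sub>o \<and> finite T\<^sub>e \<and> T\<^sub>o \<inter> T\<^sub>e = {} \<and>
       (\<forall>q\<in>T\<^sub>o. prime q) \<and> (\<forall>q\<in>T\<^sub>e. prime q) \<and>
       n\<^sub>o = (\<Prod>q\<in>T\<^sub>o. q ^ (2 * a q + 1)) \<and>
       n\<^sub>e = (\<Prod>q\<in>T\<^sub>e. q ^ (2 * b q)) \<and>
       n = n\<^sub>o * n\<^sub>e \<longrightarrow>
       schur_positive n
         (mps_smult (complex_of_real (1 / (real n\<^sub>o * sqrt (real n\<^sub>e)))) (ramanujan_symfun n)))"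
proof (intro conjI allI impI)
  define T\<^sub>o where "T\<^sub>o = {q \<in> prime_factors n. odd (multiplicity q n)}"
  define T\<^sub>e where "T\<^sub>e = {q \<in> prime_factors n. even (multiplicity q n)}"
  have "schur_positive n (mps_smult 1 (ramanujan_symfun n))"
  proof (rule schur_positive_scaled)
    show "n = (\<Prod>q\<in>T\<^sub>o. q ^ (2 * (multiplicity q n div 2) + 1)) * (\<Prod>q\<in>T\<^sub>e. q ^ (2 * (multiplicity q n div 2)))"
      unfolding T\<^sub>o_def T\<^sub>e_def by (rule odd_even_factorisation[OF assms])
    show "1 * of_nat ((\<Prod>q\<in>T\<^sub>o. q ^ (2 * (multiplicity q n div 2) + 1)) * (\<Prod>q\<in>T\<^sub>e. q ^ (multiplicity q n div 2)))
      = (of_nat ((\<Prod>q\<in>T\<^sub>o. q ^ (2 * (multiplicity q n div 2) + 1)) * (\<Prod>q\<in>T\<^sub>e. q ^ (multiplicity q n div 2))) :: complex)"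
      by (rule mult_1)
  qed (auto simp: T\<^sub>o_def T\<^sub>e_def)
  moreover have "mps_smult 1 (ramanujan_symfun n) = ramanujan_symfun n"
    by (rule mps_eqI) (simp add: mps_smult.rep_eq)
  ultimately show "schur_positive n (ramanujan_symfun n)" by simp
next
  fix T\<^sub>o T\<^sub>e :: "nat set" and a b :: "nat \<Rightarrow> nat" and n\<^sub>o n\<^sub>e :: nat
  assume H: "finite T\<^sub>o \<and> finite T\<^sub>e \<and> T\<^sub>o \<inter> T\<^sub>e = {} \<and>
       (\<forall>q\<in>T\<^sub>o. prime q) \<and> (\<forall>q\<in>T\<^sub>e. prime q) \<and>
       n\<^sub>o = (\<Prod>q\<in>T\<^sub>o. q ^ (2 * a q + 1)) \<and>
       n\<^sub>e = (\<Prod>q\<in>T\<^sub>e. q ^ (2 * b q)) \<and> n = n\<^sub>o * n\<^sub>e"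
  define E where "E = (\<Prod>q\<in>T\<^sub>e. q ^ b q)"
  have ne: "n\<^sub>e = E\<^sup>2"
    using H unfolding E_def by (simp add: prod_power_distrib mult.commute flip: power_mult)
  have "n\<^sub>o * E\<^sup>2 \<ge> 1" using H assms ne by metis
  then have "n\<^sub>o > 0" "E > 0" by (cases "n\<^sub>o = 0"; cases "E = 0"; simp)+
  then have one: "complex_of_real (1 / (real n\<^sub>o * sqrt (real n\<^sub>e))) * of_nat (n\<^sub>o * E) = of_nat 1"
    by (simp add: ne real_sqrt_power[symmetric])
  show "schur_positive n
         (mps_smult (complex_of_real (1 / (real n\<^sub>o * sqrt (real n\<^sub>e)))) (ramanujan_symfun n))"
  proof (rule schur_positive_scaled)
    show "n = (\<Prod>q\<in>T\<^sub>o. q ^ (2 * a q + 1)) * (\<Prod>q\<in>T\<^sub>e. q ^ (2 * b q))" using H by metis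
    show "complex_of_real (1 / (real n\<^sub>o * sqrt (real n\<^sub>e))) *
        of_nat ((\<Prod>q\<in>T\<^sub>o. q ^ (2 * a q + 1)) * (\<Prod>q\<in>T\<^sub>e. q ^ b q)) = of_nat 1"
      using one H unfolding E_def by metis
  qed (use H in blast)+
qed

end
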